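(* Let $0<k<1$, $k^2<b<1$ and suppose $b>-1+k^2+\dfrac{2E(k)}{K(k)}$ (nontrivial-phase solutions of butterfly type). Let $\phi=Re^{i\theta}$ be the elliptic solution with parameters $(k,b)$ and let $T=2K(k)$. Then $\phi$ is spectrally stable with respect to perturbations of the fundamental period: if $\lambda\in\mathbb C$ and $(U,V)\ne(0,0)$ satisfies $\mathcal L(U,V)^T=\lambda(U,V)^T$ and $(U,V)(x+T)=(U,V)(x)$ for all $x$, then $\operatorname{Re}\lambda=0$.
   Context: $K(k)=\int_0^{\pi/2}(1-k^2\sin^2y)^{-1/2}dy$, $E(k)=\int_0^{\pi/2}(1-k^2\sin^2y)^{1/2}dy$. The elliptic stationary solution of the focusing NLS equation $i\Psi_t+\tfrac12\Psi_{xx}+\Psi|\Psi|^2=0$ with parameters $(k,b)$ is $\Psi=e^{-i\omega t}\phi(x)$, $\phi=Re^{i\theta}$, with $R>0$, $$R^2(x)=b-k^2\operatorname{sn}^2(x,k),\quad \omega=\tfrac12(1+k^2)-\tfrac32 b,\quad c=\sqrt{b(1-b)(b-k^2)},\quad \theta(x)=\int_0^x\frac{c}{R^2(y)}\,dy.$$ Writing $\Psi=e^{-i\omega t}e^{i\theta}(R+\epsilon(u+iv)+\dots)$, the linearization is $\partial_t(u,v)^T=\mathcal L(u,v)^T$ with $$\mathcal L=\begin{pmatrix}-S&\mathcal L_-\\-\mathcal L_+&-S\end{pmatrix},\quad \mathcal L_-=-\tfrac12\partial_x^2-R^2-\omega+\frac{c^2}{2R^4},\quad \mathcal L_+=-\tfrac12\partial_x^2-3R^2-\omega+\frac{c^2}{2R^4},\quad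 S=\frac{c}{R^2}\partial_x-\frac{cR'}{R^3},$$ with $U,V$ complex-valued. The coefficients of $\mathcal L$ have period $T=2K(k)$, the fundamental period. *)

theory Defs
  imports "HOL-Analysis.Analysis"
begin

text \<open>
  \<^term>\<open>k\<close> is the elliptic modulus (not the parameter $m = k^2$). All integrals are oriented,
  so \<^term>\<open>LBINT y=0..x. f y\<close> changes sign for negative \<^term>\<open>x\<close>.
\<close>

definition ellF :: "real \<Rightarrow> real \<Rightarrow> real" where
  "ellF k x = (LBINT y=0..ereal x. 1 / sqrt (1 - k\<^sup>2 * (sin y)\<^sup>2))"

definition ellK :: "real \<Rightarrow> real" where
  "ellK k = (LBINT y=0..ereal (pi / 2). 1 / sqrt (1 - k\<^sup>2 * (sin y)\<^sup>2))"

definition ellE :: "real \<Rightarrow> real" where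
  "ellE k = (LBINT y=0..ereal (pi / 2). sqrt (1 - k\<^sup>2 * (sin y)\<^sup>2))"

text \<open>
  For $0 < k < 1$ the map \<^term>\<open>ellF k\<close> is an increasing bijection of the real line;
  its inverse is Jacobi's amplitude and $\mathrm{sn} = \sin \circ \mathrm{am}$.
\<close>

definition jacobi_am :: "real \<Rightarrow> real \<Rightarrow> real" where
  "jacobi_am k = inv (ellF k)"

definition jacobi_sn :: "real \<Rightarrow> real \<Rightarrow> real" where
  "jacobi_sn k x = sin (jacobi_am k x)"

definition sol_R :: "real \<Rightarrow> real \<Rightarrow> real \<Rightarrow> real" where
  "sol_R k b x = sqrt (b - k\<^sup>2 * (jacobi_sn k x)\<^sup>2)"

definition sol_omega :: "real \<Rightarrow> real \<Rightarrow> real" where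
  "sol_omega k b = (1 + k\<^sup>2) / 2 - 3 / 2 * b"

definition sol_c :: "real \<Rightarrow> real \<Rightarrow> real" where
  "sol_c k b = sqrt (b * (1 - b) * (b - k\<^sup>2))"

definition sol_theta :: "real \<Rightarrow> real \<Rightarrow> real \<Rightarrow> real" where
  "sol_theta k b x = (LBINT y=0..ereal x. sol_c k b / (sol_R k b y)\<^sup>2)"

definition sol_phi :: "real \<Rightarrow> real \<Rightarrow> real \<Rightarrow> complex" where
  "sol_phi k b x = of_real (sol_R k b x) * exp (\<i> * of_real (sol_theta k b x))"

text \<open>
  The operators below are the linearization about \<^term>\<open>sol_phi k b\<close>, for perturbations of the
  form $e^{-i\omega t} e^{i\theta}(R + \epsilon(u + iv))$. The factor $e^{i\theta}$ being divided
  out, the phase only enters through $\theta' = c / R^2$.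
\<close>

definition Dx :: "(real \<Rightarrow> complex) \<Rightarrow> real \<Rightarrow> complex" where
  "Dx f = (\<lambda>x. vector_derivative f (at x))"

definition twice_differentiable :: "(real \<Rightarrow> complex) \<Rightarrow> bool" where
  "twice_differentiable f \<longleftrightarrow>
     (\<forall>x. f differentiable at x) \<and> (\<forall>x. Dx f differentiable at x)"

definition op_S :: "real \<Rightarrow> real \<Rightarrow> (real \<Rightarrow> complex) \<Rightarrow> real \<Rightarrow> complex" where
  "op_S k b f = (\<lambda>x.
     of_real (sol_c k b / (sol_R k b x)\<^sup>2) * Dx f x
     - of_real (sol_c k b * deriv (sol_R k b) x / (sol_R k b x) ^ 3) * f x)"

definition op_Lminus :: "real \<Rightarrow> real \<Rightarrow> (real \<Rightarrow> complex) \<Rightarrow> real \<Rightarrow> complex" where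
  "op_Lminus k b f = (\<lambda>x.
     - (1 / 2) * Dx (Dx f) x
     + of_real (- (sol_R k b x)\<^sup>2 - sol_omega k b
                + (sol_c k b)\<^sup>2 / (2 * (sol_R k b x) ^ 4)) * f x)"

definition op_Lplus :: "real \<Rightarrow> real \<Rightarrow> (real \<Rightarrow> complex) \<Rightarrow> real \<Rightarrow> complex" where
  "op_Lplus k b f = (\<lambda>x.
     - (1 / 2) * Dx (Dx f) x
     + of_real (- 3 * (sol_R k b x)\<^sup>2 - sol_omega k b
                + (sol_c k b)\<^sup>2 / (2 * (sol_R k b x) ^ 4)) * f x)"

definition op_L :: "real \<Rightarrow> real \<Rightarrow> (real \<Rightarrow> complex) \<times> (real \<Rightarrow> complex)
    \<Rightarrow> (real \<Rightarrow> complex) \<times> (real \<Rightarrow> complex)" where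
  "op_L k b = (\<lambda>(U, V).
     (\<lambda>x. - op_S k b U x + op_Lminus k b V x,
      \<lambda>x. - op_Lplus k b U x - op_S k b V x))"

text \<open>
  Eigenfunctions are classical: \<^term>\<open>U\<close> and \<^term>\<open>V\<close> are assumed twice differentiable everywhere,
  as \<^const>\<open>vector_derivative\<close> is a total function. Continuity of the second derivatives then
  follows from the eigenvalue equation.
\<close>

definition periodic_eigenpair ::
  "real \<Rightarrow> real \<Rightarrow> real \<Rightarrow> complex \<Rightarrow> (real \<Rightarrow> complex) \<Rightarrow> (real \<Rightarrow> complex) \<Rightarrow> bool" where
  "periodic_eigenpair k b T lam U V \<longleftrightarrow>
     twice_differentiable U \<and> twice_differentiable V \<and>
     (U, V) \<noteq> (\<lambda>x. 0, \<lambda>x. 0) \<and>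
     op_L k b (U, V) = (\<lambda>x. lam * U x, \<lambda>x. lam * V x) \<and>
     (\<forall>x. U (x + T) = U x \<and> V (x + T) = V x)"

definition spectrally_stable :: "real \<Rightarrow> real \<Rightarrow> real \<Rightarrow> bool" where
  "spectrally_stable k b T \<longleftrightarrow> (\<forall>lam U V. periodic_eigenpair k b T lam U V \<longrightarrow> Re lam = 0)"

end

theory Submission imports Defs
begin

text \<open>
  Write $V = R\psi$, $h = R\psi' + 2cU/R^2$ and $M = -\frac12\partial_x^2 + W$ with
  $W = -3R^2 - \omega - \frac32 c^2/R^4$. The eigenvalue equations become
  $\lambda UR = -\frac12 (Rh)'$ and $-\lambda R\psi = MU + (c/R^2) h$. For $\lambda \ne 0$ integration
  over a period gives the two constraints $\int UR = \int Rh = 0$ (gauge and translation invariance);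
  moreover the energy $Q = \int \frac12|h|^2 + \frac12|U'|^2 + W|U|^2$ is $2i\lambda$ times a real
  number, so $Q = 0$ if $\mathrm{Re}\,\lambda \ne 0$. It remains to see that on real periodic $(U,\psi)$
  satisfying the constraints $Q \ge 0$, and $Q = 0$ forces $h = 0$, hence $U = \psi = 0$.

  Split into parities on the half period $[0,K]$, where $R'$ vanishes exactly at the ends. As $MR' = 0$,
  the form of $M$ is nonnegative on functions vanishing at $0$ and $K$, which covers odd $U$. An even
  $U$ is reduced to this case by subtracting an explicit extremal of $Q$ under the constraints with
  the same values at $0$ and $K$; by orthogonality what remains is a quadratic form in the
  two boundary values. With $r_1 = b$, $r_2 = b - k^2$, $r_3 = b - 1$ and $\beta$ the mean of $R^2$, it is
  positive definite as soon as $r_1 r_2 < \beta^2$ and $2\beta < r_1 + r_2$, which follow from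
  the equality of the means of $\mathrm{dn}^2$ and $(1-k^2)/\mathrm{dn}^2$.
\<close>

section \<open>The quadratic form in the boundary values\<close>

text \<open>
  The parameters of the extremal in \<open>extremal_exists\<close>: the equations are, in order, the
  definition of \<open>q\<close>, the relation between the coefficients \<open>n1\<close>, \<open>n2\<close> of $R'$ at the two ends,
  $\int Rh = 0$, $\int UR = 0$, $\psi(K) = 0$ and the boundary values of $RU$.
\<close>

lemma extremal_parameters:
  fixes r1 r2 r3 c \<beta> s1 s2 om e2 :: real
  assumes r: "r2 < r1" "0 < r2" "r3 < 0" and c: "0 < c" "c\<^sup>2 = - r1 * r2 * r3"
    and om: "om = - (r1 + r2 + r3) / 2" and e2: "e2 = - (r1 * r2 + r1 * r3 + r2 * r3)"
    and beta: "0 < \<beta>" "2 * \<beta> < r1 + r2" "r1 * r2 < \<beta>\<^sup>2"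
    and s: "(s1, s2) \<noteq> (0, 0)"
  shows "\<exists>a1 a2 a3 n1 n2 p q.
     c * q = e2 * a1 + 4 * om * c\<^sup>2 * a2 + 3 * c\<^sup>2 * a3 \<and>
     a3 = n2 - n1 + a2 * \<beta> \<and> p * \<beta> = - q \<and>
     a1 + a2 * e2 / 2 + a3 * \<beta> / 2 + (n2 * r2 - n1 * r1) / 2 = 0 \<and>
     - a1 * \<beta> - a2 * c\<^sup>2 + c\<^sup>2 * (n2 / r2 - n1 / r1) + c * p = 0 \<and>
     a1 + a2 * (e2 - c\<^sup>2 / r1) + a3 * r1 = s1 \<and>
     a1 + a2 * (e2 - c\<^sup>2 / r2) + a3 * r2 = s2 \<and>
     0 < n1 * (r1 - r3) / r1 * s1 + n2 * (r2 - r3) / r2 * s2"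
proof -
  \<comment> \<open>Measuring the roots from the mean \<open>\<beta>\<close> shortens the identities
    below: \<open>\<sigma>\<close> and \<open>x * y * z\<close> are the second and third elementary
    symmetric functions of the shifted roots, and \<open>\<epsilon>\<close> equals
    \<open>r1 * r2 - \<beta>\<^sup>2\<close>.\<close>
  define x where "x = r1 - \<beta>"
  define y where "y = r2 - \<beta>"
  define z where "z = r3 - \<beta>"
  have rx: "r1 = \<beta> + x" "r2 = \<beta> + y" "r3 = \<beta> + z" by (simp_all add: x_def y_def z_def)
  define \<sigma> where "\<sigma> = x * y + x * z + y * z"
  define \<Delta> where "\<Delta> = 2 * (x * y * z) * (\<beta> + x + y + z) - \<sigma>\<^sup>2 / 2"
  define \<Theta> where "\<Theta> = \<beta> * \<sigma> + 2 * (x * y * z)"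
  define \<kappa> where "\<kappa> = x * y - (x + y) * z"
  define \<epsilon> where "\<epsilon> = \<beta> * (x + y) + x * y"
  have pos: "0 < r1" "0 < x - y" "0 < x - z" "0 < y - z" "0 < x" "z < 0" "0 < x + y"
    using r beta by (auto simp: x_def y_def z_def)
  have eps: "\<epsilon> < 0" using beta(3) by (simp add: \<epsilon>_def rx power2_eq_square algebra_simps)
  have "r2\<^sup>2 < \<beta>\<^sup>2"
    using r beta(3) mult_strict_right_mono[of r2 r1 r2] unfolding power2_eq_square by linarith
  then have "y < 0" using power2_less_imp_less[of r2 \<beta>] beta(1) by (simp add: y_def)
  then have xy: "x * y < 0" using pos by (simp add: mult_pos_neg)
  then have xyz: "0 < x * y * z" using pos by (simp add: mult_neg_neg)
  have "\<Theta> = x * y * r3 + z * \<epsilon>"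
    by (simp add: \<Theta>_def \<sigma>_def \<epsilon>_def rx algebra_simps)
  moreover have "0 < x * y * r3" "0 < z * \<epsilon>" using xy r eps pos by (auto intro: mult_neg_neg)
  ultimately have Theta: "0 < \<Theta>" by linarith
  \<comment> \<open>$-c^2 = \tau\beta^2 + \sigma\beta + xyz$ is negative, so for $\tau > 0$ its discriminant $-2\Delta$ is positive.\<close>
  have Delta: "\<Delta> < 0"
  proof (cases "\<beta> + x + y + z \<le> 0")
    case True
    then have "x * y * z * (\<beta> + x + y + z) \<le> 0"
      using mult_nonneg_nonpos[of "x * y * z"] xyz by simp
    moreover have "(x + y) * z < 0" using pos by (simp add: mult_pos_neg)
    then have "\<sigma> < 0" using xy by (simp add: \<sigma>_def algebra_simps)
    then have "0 < \<sigma>\<^sup>2" by simp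
    ultimately show ?thesis unfolding \<Delta>_def by linarith
  next
    case False
    define \<tau> where "\<tau> = \<beta> + x + y + z"
    have "0 < \<tau>" using False by (simp add: \<tau>_def)
    have "- c\<^sup>2 = \<beta>\<^sup>2 * \<tau> + \<sigma> * \<beta> + x * y * z"
      unfolding c rx \<tau>_def \<sigma>_def by (simp add: algebra_simps power2_eq_square)
    then have "\<beta>\<^sup>2 * \<tau> + \<sigma> * \<beta> + x * y * z < 0"
      using zero_less_power[OF c(1), of 2] by linarith
    then have "4 * \<tau> * (\<beta>\<^sup>2 * \<tau> + \<sigma> * \<beta> + x * y * z) < 0"
      using \<open>0 < \<tau>\<close> by (simp add: mult_pos_neg)
    moreover have "4 * \<tau> * (\<beta>\<^sup>2 * \<tau> + \<sigma> * \<beta> + x * y * z) = (2 * \<tau> * \<beta> + \<sigma>)\<^sup>2 + 2 * \<Delta>"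
      unfolding \<Delta>_def \<tau>_def[symmetric] by (simp add: field_simps power2_eq_square)
    ultimately show ?thesis using zero_le_power2[of "2 * \<tau> * \<beta> + \<sigma>"] by linarith
  qed
  \<comment> \<open>\<open>\<Theta>\<close> and \<open>\<kappa>\<close> are the entries of a linear
    system with rows (\<open>\<Theta>\<close>, \<open>r1 * \<kappa>\<close>) and
    (\<open>r2 * \<kappa>\<close>, \<open>\<Theta>\<close>) linking the end coefficients to the
    boundary values. Its determinant is positive because \<open>\<Delta>\<close> and
    \<open>\<epsilon>\<close> are both negative.\<close>
  have disc: "\<Theta>\<^sup>2 - r1 * r2 * \<kappa>\<^sup>2 = 2 * \<Delta> * \<epsilon>"
    unfolding \<Theta>_def \<kappa>_def \<Delta>_def \<epsilon>_def \<sigma>_def rx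
    by (simp add: algebra_simps power2_eq_square)
  define d where "d = 2 * \<Delta> * \<epsilon>"
  have d: "0 < d" using Delta eps by (simp add: d_def mult_neg_neg)
  define t1 where "t1 = s1 / (x - y)"
  define t2 where "t2 = s2 / (x - y)"
  \<comment> \<open>Cramer's rule for this system with right-hand side \<open>t1\<close>,
    \<open>t2\<close>.\<close>
  define m1 where "m1 = (\<Theta> * t1 - r1 * \<kappa> * t2) / d"
  define m2 where "m2 = (\<Theta> * t2 - r2 * \<kappa> * t1) / d"
  have dm: "d * m1 = \<Theta> * t1 - r1 * \<kappa> * t2" "d * m2 = \<Theta> * t2 - r2 * \<kappa> * t1"
    using d by (simp_all add: m1_def m2_def)
  have d_eq: "d = \<Theta>\<^sup>2 - r1 * r2 * \<kappa>\<^sup>2" by (simp add: d_def disc)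
  have "\<Theta> * (d * m1) + r1 * \<kappa> * (d * m2) = d * t1" "\<Theta> * (d * m2) + r2 * \<kappa> * (d * m1) = d * t2"
    unfolding dm by (simp_all add: d_eq algebra_simps power2_eq_square)
  then have "d * (\<Theta> * m1 + r1 * \<kappa> * m2) = d * t1" "d * (\<Theta> * m2 + r2 * \<kappa> * m1) = d * t2"
    by (simp_all add: algebra_simps)
  then have t: "\<Theta> * m1 + r1 * \<kappa> * m2 = t1" "\<Theta> * m2 + r2 * \<kappa> * m1 = t2"
    using d by simp_all
  have Q: "0 < m1 / r1 * t1 + m2 / r2 * t2"
  proof -
    have "\<Theta> * (r1 * r2) * (m1 / r1 * t1 + m2 / r2 * t2) = \<Theta> * (r2 * m1 * t1 + r1 * m2 * t2)"
      using pos r by (simp add: field_simps)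
    \<comment> \<open>Completing the square: \<open>\<Theta> * m1\<close> is replaced by
      \<open>t1 - r1 * \<kappa> * m2\<close>, and the remaining coefficient of
      \<open>m2\<^sup>2\<close> is \<open>r1\<close> times the determinant \<open>d\<close>.\<close>
    also have "\<dots> = r2 * (t1\<^sup>2 + r1 / r2 * d * m2\<^sup>2)"
      unfolding d_eq t[symmetric] using r by (simp add: field_simps power2_eq_square)
    also have "\<dots> > 0"
    proof -
      have "t1 \<noteq> 0 \<or> m2 \<noteq> 0"
      proof (rule ccontr)
        assume "\<not> ?thesis"
        then have *: "t1 = 0" "m2 = 0" by auto
        then have "m1 = 0" using t(1) Theta by simp
        then have "t2 = 0" using t(2) * by simp
        then show False using * s pos by (auto simp: t1_def t2_def)
      qed
      moreover have "0 \<le> r1 / r2 * d * m2\<^sup>2" "m2 \<noteq> 0 \<Longrightarrow> 0 < r1 / r2 * d * m2\<^sup>2"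
        using pos r d by auto
      ultimately have "0 < t1\<^sup>2 + r1 / r2 * d * m2\<^sup>2"
        by (cases "m2 = 0") (auto intro: add_nonneg_pos)
      then show ?thesis using r by simp
    qed
    finally show ?thesis
      by (rule zero_less_mult_pos) (use Theta pos r in simp)
  qed
  define l1 where "l1 = m1 / (x - z)"
  define l2 where "l2 = m2 / (y - z)"
  have l: "m1 = (x - z) * l1" "m2 = (y - z) * l2" using pos by (simp_all add: l1_def l2_def)
  \<comment> \<open>Once \<open>a1\<close>, \<open>a3\<close>, \<open>p\<close> and \<open>q\<close>
    are eliminated, the condition at the right end for psi reads
    \<open>n2 * X2 - n1 * X1 = \<Delta> * a2\<close>.\<close>
  define X1 where "X1 = \<beta> * (\<sigma> - x\<^sup>2) + 3 * (x * y * z) - \<sigma> * x / 2"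
  define X2 where "X2 = \<beta> * (\<sigma> - y\<^sup>2) + 3 * (x * y * z) - \<sigma> * y / 2"
  have Delta_eq: "\<Delta> = 4 * c\<^sup>2 * (\<beta> + om) - (\<beta>\<^sup>2 + e2)\<^sup>2 / 2"
    unfolding \<Delta>_def \<sigma>_def om e2 c(2) rx by (simp add: field_simps power2_eq_square)
  have X_eq: "X1 = - r2 * r3 * (\<beta> - 3 * r1) + (\<beta>\<^sup>2 + e2) * (\<beta> + r1) / 2"
    "X2 = - r1 * r3 * (\<beta> - 3 * r2) + (\<beta>\<^sup>2 + e2) * (\<beta> + r2) / 2"
    unfolding X1_def X2_def \<sigma>_def e2 rx by (simp_all add: field_simps power2_eq_square)
  \<comment> \<open>The factor \<open>- 2 * \<Delta>\<close> allows that condition to be solved for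
    \<open>a2\<close> without division; being positive, it also carries the sign of \<open>Q\<close>
    over to the final form.\<close>
  define n1 where "n1 = - 2 * \<Delta> * l1"
  define n2 where "n2 = - 2 * \<Delta> * l2"
  define a2 where "a2 = - 2 * (l2 * X2 - l1 * X1)"
  define a1 where "a1 = - (n2 * (\<beta> + r2) - n1 * (\<beta> + r1)) / 2 - a2 * (\<beta>\<^sup>2 + e2) / 2"
  define a3 where "a3 = n2 - n1 + a2 * \<beta>"
  define q where "q = (e2 * a1 + 4 * om * c\<^sup>2 * a2 + 3 * c\<^sup>2 * a3) / c"
  define p where "p = - q / \<beta>"
  have cq: "c * q = e2 * a1 + 4 * om * c\<^sup>2 * a2 + 3 * c\<^sup>2 * a3" using c by (simp add: q_def)
  have c1: "a1 + a2 * e2 / 2 + a3 * \<beta> / 2 + (n2 * r2 - n1 * r1) / 2 = 0"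
    by (simp add: a1_def a3_def field_simps power2_eq_square)
  have cr: "c\<^sup>2 / r1 = - r2 * r3" "c\<^sup>2 / r2 = - r1 * r3" using c(2) pos r by simp_all
  have psi: "- a1 * \<beta> - a2 * c\<^sup>2 + c\<^sup>2 * (n2 / r2 - n1 / r1) + c * p = 0"
  proof -
    \<comment> \<open>Multiplying by \<open>\<beta>\<close> turns \<open>p\<close> into
      \<open>- q\<close>, so that \<open>cq\<close> can be inserted.\<close>
    have "\<beta> * (- a1 * \<beta> - a2 * c\<^sup>2 + c\<^sup>2 * (n2 / r2 - n1 / r1) + c * p)
      = \<beta> * (- a1 * \<beta> - a2 * c\<^sup>2 + n2 * (c\<^sup>2 / r2) - n1 * (c\<^sup>2 / r1)) - c * q"
      using beta(1) by (simp add: p_def algebra_simps)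
    also have "\<dots> = (n2 * X2 - n1 * X1) - \<Delta> * a2"
      unfolding cr cq a1_def a3_def Delta_eq X_eq om e2 c(2) using pos(1) r(2) by (simp add: field_simps power2_eq_square)
    also have "\<dots> = 0" by (simp add: n1_def n2_def a2_def algebra_simps)
    finally show ?thesis using beta(1) by simp
  qed
  have Y: "e2 - c\<^sup>2 / r1 + \<beta> * r1 - (\<beta>\<^sup>2 + e2) / 2 = - (\<sigma> - 2 * (y * z)) / 2"
    "e2 - c\<^sup>2 / r2 + \<beta> * r2 - (\<beta>\<^sup>2 + e2) / 2 = - (\<sigma> - 2 * (x * z)) / 2"
    unfolding cr unfolding \<sigma>_def e2 rx by (simp_all add: field_simps power2_eq_square)
  \<comment> \<open>The coefficients of \<open>l1\<close> and \<open>l2\<close> in either boundary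
    value factor with \<open>x - y\<close> and with exactly the difference \<open>x - z\<close> or
    \<open>y - z\<close> that converts \<open>l1\<close>, \<open>l2\<close> back to
    \<open>m1\<close>, \<open>m2\<close>.\<close>
  have "a1 + a2 * (e2 - c\<^sup>2 / r1) + a3 * r1
      = a2 * (e2 - c\<^sup>2 / r1 + \<beta> * r1 - (\<beta>\<^sup>2 + e2) / 2) + n2 * (2 * x - y) / 2 - n1 * x / 2"
    unfolding a1_def a3_def rx by (simp add: field_simps)
  also have "\<dots> = l1 * (\<Delta> * x - X1 * (\<sigma> - 2 * (y * z))) + l2 * (X2 * (\<sigma> - 2 * (y * z)) - \<Delta> * (2 * x - y))"
    unfolding Y a2_def n1_def n2_def by (simp add: field_simps)
  also have "\<Delta> * x - X1 * (\<sigma> - 2 * (y * z)) = (x - y) * (x - z) * \<Theta>"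
    unfolding X1_def \<Delta>_def \<Theta>_def \<sigma>_def by (simp add: field_simps power2_eq_square)
  also have "X2 * (\<sigma> - 2 * (y * z)) - \<Delta> * (2 * x - y) = (x - y) * (y - z) * (\<kappa> * r1)"
    unfolding X2_def \<Delta>_def \<kappa>_def \<sigma>_def rx by (simp add: field_simps power2_eq_square)
  finally have U1: "a1 + a2 * (e2 - c\<^sup>2 / r1) + a3 * r1 = (x - y) * (\<Theta> * m1 + r1 * \<kappa> * m2)"
    unfolding l by (simp add: algebra_simps)
  have "a1 + a2 * (e2 - c\<^sup>2 / r2) + a3 * r2
      = a2 * (e2 - c\<^sup>2 / r2 + \<beta> * r2 - (\<beta>\<^sup>2 + e2) / 2) + n2 * y / 2 - n1 * (2 * y - x) / 2"
    unfolding a1_def a3_def rx by (simp add: field_simps)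
  also have "\<dots> = l1 * (\<Delta> * (2 * y - x) - X1 * (\<sigma> - 2 * (x * z))) + l2 * (X2 * (\<sigma> - 2 * (x * z)) - \<Delta> * y)"
    unfolding Y a2_def n1_def n2_def by (simp add: field_simps)
  also have "\<Delta> * (2 * y - x) - X1 * (\<sigma> - 2 * (x * z)) = (x - y) * (x - z) * (\<kappa> * r2)"
    unfolding X1_def \<Delta>_def \<kappa>_def \<sigma>_def rx by (simp add: field_simps power2_eq_square)
  also have "X2 * (\<sigma> - 2 * (x * z)) - \<Delta> * y = (x - y) * (y - z) * \<Theta>"
    unfolding X2_def \<Delta>_def \<Theta>_def \<sigma>_def by (simp add: field_simps power2_eq_square)
  finally have U2: "a1 + a2 * (e2 - c\<^sup>2 / r2) + a3 * r2 = (x - y) * (\<Theta> * m2 + r2 * \<kappa> * m1)"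
    unfolding l by (simp add: algebra_simps)
  have ts: "(x - y) * t1 = s1" "(x - y) * t2 = s2" using pos by (simp_all add: t1_def t2_def)
  have "n1 * (r1 - r3) / r1 * s1 + n2 * (r2 - r3) / r2 * s2
      = - 2 * \<Delta> * (x - y) * (m1 / r1 * t1 + m2 / r2 * t2)"
    unfolding n1_def n2_def l ts[symmetric] rx by (simp add: algebra_simps)
  also have "\<dots> > 0" using Delta pos Q by (simp add: mult_neg_pos)
  finally have N: "0 < n1 * (r1 - r3) / r1 * s1 + n2 * (r2 - r3) / r2 * s2" .
  have pb: "p * \<beta> = - q" using beta(1) by (simp add: p_def)
  show ?thesis
    using cq a3_def pb c1 psi U1[unfolded t ts] U2[unfolded t ts] N by blast
qed

section \<open>Real analysis\<close>

text \<open>Near \<open>a\<close> the quotient is \<open>u\<close> times a ratio of difference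
  quotients, so it tends to 0 times \<open>u' / f'\<close>. The value at \<open>a\<close> is 0 / 0,
  which is 0 by convention and agrees with the limit.\<close>

lemma isCont_square_over_zero:
  fixes u f :: "real \<Rightarrow> real"
  assumes u: "(u has_real_derivative u') (at a)" and f: "(f has_real_derivative f') (at a)"
    and z: "u a = 0" "f a = 0" "f' \<noteq> 0"
  shows "isCont (\<lambda>x. (u x)\<^sup>2 / f x) a"
proof -
  have "((\<lambda>x. u x / (x - a)) \<longlongrightarrow> u') (at a)" "((\<lambda>x. f x / (x - a)) \<longlongrightarrow> f') (at a)"
    using u f z by (simp_all add: has_field_derivative_iff)
  then have "((\<lambda>x. u x * ((u x / (x - a)) / (f x / (x - a)))) \<longlongrightarrow> u a * (u' / f')) (at a)"
    using DERIV_isCont[OF u] z(3) by (intro tendsto_intros) (auto simp: isCont_def)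
  then have "((\<lambda>x. u x * ((u x / (x - a)) / (f x / (x - a)))) \<longlongrightarrow> 0) (at a)" by (simp add: z)
  moreover have "v * ((v / h) / (w / h)) = v\<^sup>2 / w" if "h \<noteq> 0" for v w h :: real
    using that by (simp add: power2_eq_square)
  then have "\<forall>\<^sub>F x in at a. u x * ((u x / (x - a)) / (f x / (x - a))) = (u x)\<^sup>2 / f x"
    by (auto simp: eventually_at_filter intro!: always_eventually)
  ultimately have "((\<lambda>x. (u x)\<^sup>2 / f x) \<longlongrightarrow> 0) (at a)" by (rule Lim_transform_eventually)
  then show ?thesis by (simp add: isCont_def z)
qed

lemma has_integral_derivative:
  fixes F :: "real \<Rightarrow> real"
  assumes "a \<le> b" "\<And>x. (F has_real_derivative f x) (at x)"
  shows "(f has_integral F b - F a) {a..b}"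
  using assms by (intro fundamental_theorem_of_calculus)
    (auto simp: has_real_derivative_iff_has_vector_derivative[symmetric] intro: has_field_derivative_at_within)

lemma has_real_derivative_LBINT:
  fixes f :: "real \<Rightarrow> real"
  assumes f: "\<And>A. continuous_on A f"
  shows "((\<lambda>u. LBINT y=ereal 0..ereal u. f y) has_real_derivative f x) (at x)"
proof -
  define L where "L = \<bar>x\<bar> + 1"
  have "((\<lambda>u. LBINT y=ereal 0..ereal u. f y) has_vector_derivative f x) (at x within {-L..L})"
    by (rule interval_integral_FTC2) (auto simp: L_def intro: f)
  moreover have "x \<in> interior {-L..L}" by (auto simp: L_def)
  ultimately show ?thesis
    by (metis at_within_interior has_real_derivative_iff_has_vector_derivative)
qed

lemma integral_symmetric_interval:
  fixes f :: "real \<Rightarrow> real"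
  assumes f: "continuous_on UNIV f" and a: "0 \<le> a"
  shows "integral {-a..a} f = integral {0..a} (\<lambda>x. f x + f (- x))"
proof -
  have c: "continuous_on A f" "continuous_on A (\<lambda>x. f (- x))" for A
    using continuous_on_subset[OF f]
    by (auto intro!: continuous_on_compose2[OF f] continuous_intros)
  have "integral {-a..a} f = integral {-a..0} f + integral {0..a} f"
    using a c by (intro Henstock_Kurzweil_Integration.integral_combine[symmetric] integrable_continuous_real) auto
  also have "integral {-a..0} f = integral {0..a} (\<lambda>x. f (- x))"
    using Henstock_Kurzweil_Integration.integral_reflect_real[of a 0 "\<lambda>x. f (- x)"] by simp
  also have "integral {0..a} (\<lambda>x. f (- x)) + integral {0..a} f = integral {0..a} (\<lambda>x. f x + f (- x))"
    using c by (subst integral_add) (auto intro!: integrable_continuous_real simp: add.commute)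
  finally show ?thesis .
qed

text \<open>The hypotheses are the real and imaginary parts of lambda times the integral of p + iq,
  with lambda = \<mu> + i \<sigma>. Multiplication by the conjugate of lambda isolates both
  integrals up to the nonzero factor \<open>\<mu>\<^sup>2 + \<sigma>\<^sup>2\<close>.\<close>

lemma has_integral_rotation:
  fixes p q :: "real \<Rightarrow> real"
  assumes "((\<lambda>x. \<mu> * p x - \<sigma> * q x) has_integral 0) S" "((\<lambda>x. \<sigma> * p x + \<mu> * q x) has_integral 0) S"
    and "\<mu> \<noteq> 0"
  shows "(p has_integral 0) S" "(q has_integral 0) S"
proof -
  have nz: "\<mu>\<^sup>2 + \<sigma>\<^sup>2 \<noteq> 0" using assms(3) by (simp add: sum_power2_eq_zero_iff)
  have "((\<lambda>x. \<mu> * (\<mu> * p x - \<sigma> * q x) + \<sigma> * (\<sigma> * p x + \<mu> * q x)) has_integral \<mu> * 0 + \<sigma> * 0) S"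
    by (intro has_integral_add has_integral_mult_right assms)
  moreover have "\<mu> * (\<mu> * p x - \<sigma> * q x) + \<sigma> * (\<sigma> * p x + \<mu> * q x) = (\<mu>\<^sup>2 + \<sigma>\<^sup>2) * p x" for x
    by (simp add: algebra_simps power2_eq_square)
  ultimately have "((\<lambda>x. (\<mu>\<^sup>2 + \<sigma>\<^sup>2) * p x) has_integral 0) S" by simp
  from has_integral_mult_right[OF this, of "inverse (\<mu>\<^sup>2 + \<sigma>\<^sup>2)"] show "(p has_integral 0) S"
    using nz by (simp flip: mult.assoc)
  have "((\<lambda>x. \<mu> * (\<sigma> * p x + \<mu> * q x) - \<sigma> * (\<mu> * p x - \<sigma> * q x)) has_integral \<mu> * 0 - \<sigma> * 0) S"
    by (intro has_integral_diff has_integral_mult_right assms)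
  moreover have "\<mu> * (\<sigma> * p x + \<mu> * q x) - \<sigma> * (\<mu> * p x - \<sigma> * q x) = (\<mu>\<^sup>2 + \<sigma>\<^sup>2) * q x" for x
    by (simp add: algebra_simps power2_eq_square)
  ultimately have "((\<lambda>x. (\<mu>\<^sup>2 + \<sigma>\<^sup>2) * q x) has_integral 0) S" by simp
  from has_integral_mult_right[OF this, of "inverse (\<mu>\<^sup>2 + \<sigma>\<^sup>2)"] show "(q has_integral 0) S"
    using nz by (simp flip: mult.assoc)
qed

lemma periodic_deriv:
  fixes u :: "real \<Rightarrow> real"
  assumes u: "\<And>x. (u has_real_derivative u1 x) (at x)" and per: "\<And>x. u (x + T) = u x"
  shows "u1 (x + T) = u1 x"
proof -
  have "((\<lambda>x. u (x + T)) has_real_derivative u1 (x + T)) (at x)"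
    using u[of "x + T"] by (simp add: DERIV_shift)
  then show ?thesis using per u[of x] by (simp add: DERIV_unique)
qed

lemma periodic_zero:
  fixes f :: "real \<Rightarrow> real"
  assumes per: "\<And>x. f (x + 2 * a) = f x" and a: "0 < a" and zero: "\<And>x. x \<in> {-a..a} \<Longrightarrow> f x = 0"
  shows "f x = 0"
proof -
  have shift: "f (y + of_int n * (2 * a)) = f y" for y n
  proof (induction n rule: int_induct[where k = 0])
    case (step1 i)
    then show ?case using per[of "y + of_int i * (2 * a)"] by (simp add: algebra_simps)
  next
    case (step2 i)
    then show ?case using per[of "y + of_int (i - 1) * (2 * a)"] by (simp add: algebra_simps)
  qed simp
  define n where "n = \<lfloor>(x + a) / (2 * a)\<rfloor>"
  have "of_int n \<le> (x + a) / (2 * a)" "(x + a) / (2 * a) < of_int n + 1"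
    by (simp_all add: n_def)
  then have "of_int n * (2 * a) \<le> x + a" "x + a < (of_int n + 1) * (2 * a)"
    using a by (simp_all add: pos_le_divide_eq pos_divide_less_eq)
  then have "x - of_int n * (2 * a) \<in> {-a..a}" by (auto simp: algebra_simps)
  then show ?thesis using zero shift[of "x - of_int n * (2 * a)" n] by simp
qed

section \<open>Jacobi amplitude and the wave profile\<close>

locale elliptic_wave =
  fixes k b :: real
  assumes k0: "0 < k" and k1: "k < 1" and bk: "k\<^sup>2 < b" and b1: "b < 1"
begin

section \<open>The elliptic integral, its inverse and dn\<close>

definition ell_dens :: "real \<Rightarrow> real" where
  "ell_dens y = 1 / sqrt (1 - k\<^sup>2 * (sin y)\<^sup>2)"

lemma ksin: "0 < 1 - k\<^sup>2 * (sin y)\<^sup>2"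
proof -
  have "k\<^sup>2 < 1" using k0 k1 by (simp add: power_less_one_iff abs_square_less_1)
  moreover have "k\<^sup>2 * (sin y)\<^sup>2 \<le> k\<^sup>2 * 1"
    by (intro mult_left_mono) (auto simp: abs_square_le_1)
  ultimately show ?thesis by linarith
qed

lemma ell_dens_ge_1: "1 \<le> ell_dens y"
proof -
  have "sqrt (1 - k\<^sup>2 * (sin y)\<^sup>2) \<le> sqrt 1" by (intro real_sqrt_le_mono) simp
  then show ?thesis using ksin[of y] by (simp add: ell_dens_def)
qed

lemma continuous_ell_dens: "continuous_on A ell_dens"
  unfolding ell_dens_def using ksin by (intro continuous_intros) (auto simp: less_imp_neq[symmetric])

lemma ellF_eq: "ellF k = (\<lambda>u. LBINT y=ereal 0..ereal u. ell_dens y)"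
  by (simp add: ellF_def ell_dens_def fun_eq_iff zero_ereal_def)

lemma ellF_deriv: "(ellF k has_real_derivative ell_dens x) (at x)"
  unfolding ellF_eq by (rule has_real_derivative_LBINT) (rule continuous_ell_dens)

lemma ellF_0: "ellF k 0 = 0"
  by (simp add: ellF_def flip: zero_ereal_def)

lemma ellF_halfpi: "ellF k (pi / 2) = ellK k"
  by (simp add: ellF_def ellK_def)

text \<open>The integrand is at least 1. This single estimate yields strict monotonicity and, with
  the intermediate value theorem, surjectivity.\<close>

lemma ellF_add_le: assumes "x \<le> y" shows "y - x \<le> ellF k y - ellF k x"
proof -
  have "ellF k x - x \<le> ellF k y - y"
  proof (rule DERIV_nonneg_imp_nondecreasing[OF assms])
    fix z
    show "\<exists>D. ((\<lambda>x. ellF k x - x) has_real_derivative D) (at z) \<and> 0 \<le> D"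
      using ell_dens_ge_1[of z] by (auto intro!: exI[of _ "ell_dens z - 1"] derivative_eq_intros ellF_deriv)
  qed
  then show ?thesis by linarith
qed

lemma ellF_strict_mono: "strict_mono (ellF k)"
proof (rule strict_monoI)
  fix x y :: real assume "x < y" then show "ellF k x < ellF k y"
    using ellF_add_le[of x y] by linarith
qed

lemma ellF_surj: "\<exists>x. ellF k x = y"
proof -
  have "ellF k (- \<bar>y\<bar>) \<le> y" "y \<le> ellF k \<bar>y\<bar>"
    using ellF_add_le[of "-\<bar>y\<bar>" 0] ellF_add_le[of 0 "\<bar>y\<bar>"] by (auto simp: ellF_0)
  moreover have "isCont (ellF k) x" for x using ellF_deriv DERIV_isCont by blast
  ultimately show ?thesis using IVT[of "ellF k" "-\<bar>y\<bar>" y "\<bar>y\<bar>"] by auto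
qed

lemma ellF_minus: "ellF k (- x) = - ellF k x"
proof -
  have "((\<lambda>x. ellF k (- x) + ellF k x) has_real_derivative 0) (at x)" for x
    by (auto intro!: derivative_eq_intros DERIV_chain2[where f = "ellF k" and g = "\<lambda>x. - x"] ellF_deriv simp: ell_dens_def)
  then have "ellF k (- x) + ellF k x = ellF k (- 0) + ellF k 0"
    by (rule DERIV_isconst_all[OF allI])
  then show ?thesis by (simp add: ellF_0)
qed

lemma ellF_add_pi: "ellF k (x + pi) = ellF k x + 2 * ellK k"
proof -
  have d: "((\<lambda>x. ellF k (x + pi) - ellF k x) has_real_derivative 0) (at x)" for x
    by (auto intro!: derivative_eq_intros DERIV_chain2[where f = "ellF k" and g = "\<lambda>x. x + pi"] ellF_deriv simp: ell_dens_def)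
  \<comment> \<open>The constant difference is evaluated at -pi/2, where oddness gives twice the
    complete integral.\<close>
  have "ellF k (x + pi) - ellF k x = ellF k (- (pi/2) + pi) - ellF k (- (pi/2))"
    using DERIV_isconst_all[OF allI, OF d] .
  then show ?thesis using ellF_minus[of "pi/2"] by (simp add: ellF_halfpi)
qed

definition am :: "real \<Rightarrow> real" where "am = jacobi_am k"

abbreviation KK :: real where "KK \<equiv> ellK k"

lemma ellF_am: "ellF k (am x) = x"
  unfolding am_def jacobi_am_def using ellF_surj by (metis surj_def surj_f_inv_f)

lemma am_ellF: "am (ellF k x) = x"
  unfolding am_def jacobi_am_def using ellF_strict_mono by (simp add: strict_mono_imp_inj_on)

lemma am_eqI: "ellF k y = x \<Longrightarrow> am x = y"
  using am_ellF by blast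

lemma KK_pos: "0 < KK"
  using ellF_add_le[of 0 "pi/2"] pi_gt_zero by (simp add: ellF_0 ellF_halfpi del: pi_gt_zero)

lemma am_0: "am 0 = 0" by (rule am_eqI) (rule ellF_0)

lemma am_KK: "am KK = pi / 2" by (rule am_eqI) (rule ellF_halfpi)

lemma am_minus: "am (- x) = - am x" by (rule am_eqI) (simp add: ellF_minus ellF_am)

lemma am_add_period: "am (x + 2 * KK) = am x + pi" by (rule am_eqI) (simp add: ellF_add_pi ellF_am)

lemma am_less: "x < y \<Longrightarrow> am x < am y"
  using ellF_strict_mono ellF_am by (metis strict_mono_less)

definition dn :: "real \<Rightarrow> real" where "dn x = sqrt (1 - k\<^sup>2 * (sin (am x))\<^sup>2)"

lemma dn_pos: "0 < dn x" using ksin by (simp add: dn_def)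

lemma dn_sq: "(dn x)\<^sup>2 = 1 - k\<^sup>2 * (sin (am x))\<^sup>2"
  using ksin[of "am x"] by (simp add: dn_def)

lemma am_deriv: "(am has_real_derivative dn x) (at x)"
proof -
  have "(am has_real_derivative inverse (ell_dens (am x))) (at x)"
  proof (rule DERIV_inverse_function[where f = "ellF k" and a = "x - 1" and b = "x + 1"])
    show "(ellF k has_real_derivative ell_dens (am x)) (at (am x))" by (rule ellF_deriv)
    show "ell_dens (am x) \<noteq> 0" using ell_dens_ge_1[of "am x"] by linarith
    show "isCont am x"
      using isCont_inverse_function2[of "am x - 1" "am x" "am x + 1" am "ellF k"] am_ellF ellF_am
         DERIV_isCont[OF ellF_deriv] by auto
  qed (auto simp: ellF_am)
  then show ?thesis by (simp add: ell_dens_def dn_def)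
qed

lemma sin_cos_am_pos:
  assumes "0 < x" "x < KK" shows "0 < sin (am x)" "0 < cos (am x)"
  using am_less[of 0 x] am_less[of x KK] assms
  by (auto simp: am_0 am_KK intro!: sin_gt_zero cos_gt_zero)

section \<open>The squared profile and its cubic\<close>

definition rho :: "real \<Rightarrow> real" where "rho x = b - k\<^sup>2 * (sin (am x))\<^sup>2"

definition rho1 :: "real \<Rightarrow> real" where
  "rho1 x = - 2 * k\<^sup>2 * sin (am x) * cos (am x) * dn x"

definition om :: real where "om = sol_omega k b"

text \<open>Twice the first integral: $R'^2 = -R^4 - 2\omega R^2 + e_2 - c^2/R^2$.\<close>

definition e2 :: real where "e2 = - (b * (b - k\<^sup>2) + b * (b - 1) + (b - k\<^sup>2) * (b - 1))"

definition cc :: real where "cc = sol_c k b"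

lemma om_eq: "om = (1 + k\<^sup>2 - 3 * b) / 2"
  by (simp add: om_def sol_omega_def field_simps)

lemma b_pos: "0 < b" using bk zero_le_power2[of k] by linarith

lemma k2_bounds: "0 < k\<^sup>2" "k\<^sup>2 < 1"
  using k0 k1 by (auto simp: power_less_one_iff abs_square_less_1)

lemma cc_pos: "0 < cc"
  using b_pos bk b1 by (simp add: cc_def sol_c_def)

lemma cc_sq: "cc\<^sup>2 = b * (1 - b) * (b - k\<^sup>2)"
  using b_pos bk b1 by (simp add: cc_def sol_c_def)

lemma rho_pos: "0 < rho x"
proof -
  have "k\<^sup>2 * (sin (am x))\<^sup>2 \<le> k\<^sup>2 * 1"
    by (intro mult_left_mono) (auto simp: abs_square_le_1)
  then show ?thesis using bk by (simp add: rho_def)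
qed

lemma dn_deriv: "(dn has_real_derivative - k\<^sup>2 * sin (am x) * cos (am x)) (at x)"
proof -
  have "((\<lambda>x. sqrt (1 - k\<^sup>2 * (sin (am x))\<^sup>2)) has_real_derivative
     - k\<^sup>2 * sin (am x) * cos (am x)) (at x)"
    using ksin[of "am x"] dn_pos[of x]
    by (auto intro!: derivative_eq_intros DERIV_chain2[of sqrt] am_deriv simp: dn_def field_simps)
  then show ?thesis by (simp add: dn_def[abs_def])
qed

lemma rho_deriv: "(rho has_real_derivative rho1 x) (at x)"
  unfolding rho_def[abs_def] rho1_def
  by (auto intro!: derivative_eq_intros am_deriv)

text \<open>The right-hand side is -4 times the product of rho - b, rho - (b - k^2) and rho - (b -
  1), which are -k^2 sn^2, k^2 cn^2 and dn^2.\<close>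

lemma rho1_sq: "(rho1 x)\<^sup>2 = - 4 * rho x ^ 3 - 8 * om * (rho x)\<^sup>2 + 4 * e2 * rho x - 4 * cc\<^sup>2"
proof -
  define S where "S = (sin (am x))\<^sup>2"
  have c: "(cos (am x))\<^sup>2 = 1 - S" by (simp add: S_def cos_squared_eq)
  have "(rho1 x)\<^sup>2 = 4 * (k\<^sup>2)\<^sup>2 * S * (1 - S) * (1 - k\<^sup>2 * S)"
    unfolding rho1_def by (simp add: power_mult_distrib dn_sq c flip: S_def)
  then show ?thesis
    unfolding rho_def cc_sq e2_def om_eq S_def[symmetric]
    by (simp add: power2_eq_square power3_eq_cube field_simps)
qed

text \<open>Differentiating the product directly avoids cancelling \<open>rho1\<close> from the
  derivative of \<open>rho1_sq\<close>, which would fail where \<open>rho1\<close> vanishes.\<close>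

lemma rho1_deriv: "(rho1 has_real_derivative - 6 * (rho x)\<^sup>2 - 8 * om * rho x + 2 * e2) (at x)"
proof -
  define S where "S = (sin (am x))\<^sup>2"
  have c: "(cos (am x))\<^sup>2 = 1 - S" by (simp add: S_def cos_squared_eq)
  have "(rho1 has_real_derivative
     - 2 * k\<^sup>2 * ((cos (am x))\<^sup>2 * (dn x)\<^sup>2 - (sin (am x))\<^sup>2 * (dn x)\<^sup>2
         - k\<^sup>2 * (sin (am x))\<^sup>2 * (cos (am x))\<^sup>2)) (at x)"
    unfolding rho1_def[abs_def]
    by (auto intro!: derivative_eq_intros am_deriv dn_deriv simp: algebra_simps power2_eq_square)
  moreover have "- 2 * k\<^sup>2 * ((cos (am x))\<^sup>2 * (dn x)\<^sup>2 - (sin (am x))\<^sup>2 * (dn x)\<^sup>2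
         - k\<^sup>2 * (sin (am x))\<^sup>2 * (cos (am x))\<^sup>2) = - 6 * (rho x)\<^sup>2 - 8 * om * rho x + 2 * e2"
    unfolding dn_sq c S_def[symmetric] rho_def e2_def om_eq
    by (simp add: power2_eq_square field_simps)
  ultimately show ?thesis by simp
qed

lemma rho_minus: "rho (- x) = rho x" by (simp add: rho_def am_minus)

lemma rho1_minus: "rho1 (- x) = - rho1 x" by (simp add: rho1_def am_minus dn_def)

lemma rho_period: "rho (x + 2 * KK) = rho x" by (simp add: rho_def am_add_period)

lemma rho1_period: "rho1 (x + 2 * KK) = rho1 x" by (simp add: rho1_def am_add_period dn_def)

lemma rho_0: "rho 0 = b" by (simp add: rho_def am_0)

lemma rho_KK: "rho KK = b - k\<^sup>2" by (simp add: rho_def am_KK)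

lemma rho1_0: "rho1 0 = 0" by (simp add: rho1_def am_0)

lemma rho1_KK: "rho1 KK = 0" by (simp add: rho1_def am_KK)

lemma rho1_neg: "0 < x \<Longrightarrow> x < KK \<Longrightarrow> rho1 x < 0"
  using sin_cos_am_pos[of x] dn_pos[of x] k2_bounds by (simp add: rho1_def)

section \<open>The profile R and its translation mode\<close>

definition R :: "real \<Rightarrow> real" where "R x = sqrt (rho x)"

definition R1 :: "real \<Rightarrow> real" where "R1 x = rho1 x / (2 * R x)"

definition R2 :: "real \<Rightarrow> real" where "R2 x = - 2 * R x ^ 3 - 2 * om * R x + cc\<^sup>2 / R x ^ 3"

definition W :: "real \<Rightarrow> real" where "W x = - 3 * rho x - om - 3 / 2 * cc\<^sup>2 / (rho x)\<^sup>2"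

lemma R_pos: "0 < R x" using rho_pos by (simp add: R_def)

lemma R_sq: "(R x)\<^sup>2 = rho x" using rho_pos[of x] by (simp add: R_def)

lemma rho_eq: "rho x = R x * R x" using R_sq[of x] by (simp add: power2_eq_square)

lemma rho1_eq: "rho1 x = 2 * R x * R1 x" using R_pos[of x] by (simp add: R1_def)

lemma R_sol_R: "sol_R k b = R"
  by (simp add: fun_eq_iff sol_R_def R_def rho_def jacobi_sn_def am_def)

lemma R_deriv: "(R has_real_derivative R1 x) (at x)"
  unfolding R_def[abs_def] R1_def using rho_pos[of x]
  by (auto intro!: derivative_eq_intros rho_deriv DERIV_chain2[of sqrt] simp: field_simps)

lemma R1_sq: "(R1 x)\<^sup>2 = - (R x ^ 4) - 2 * om * (R x)\<^sup>2 + e2 - cc\<^sup>2 / (R x)\<^sup>2"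
proof -
  have "4 * (R x)\<^sup>2 * (R1 x)\<^sup>2 = (rho1 x)\<^sup>2" by (simp add: rho1_eq power_mult_distrib)
  also have "\<dots> = 4 * (R x)\<^sup>2 * (- (R x ^ 4) - 2 * om * (R x)\<^sup>2 + e2 - cc\<^sup>2 / (R x)\<^sup>2)"
    unfolding rho1_sq R_sq[symmetric] using R_pos[of x] by (simp add: field_simps eval_nat_numeral)
  finally show ?thesis using R_pos[of x] by simp
qed

text \<open>\<open>R2\<close> is the right-hand side of the profile equation; it arises from the
  quotient rule once \<open>R1_sq\<close> eliminates the squared derivative.\<close>

lemma R1_deriv: "(R1 has_real_derivative R2 x) (at x)"
proof -
  have "(R1 has_real_derivative
      ((- 6 * (rho x)\<^sup>2 - 8 * om * rho x + 2 * e2) * (2 * R x) - rho1 x * (2 * R1 x)) / (2 * R x)\<^sup>2) (at x)"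
    unfolding R1_def[abs_def] using R_pos[of x]
    by (auto intro!: derivative_eq_intros rho1_deriv R_deriv simp: power2_eq_square R1_def)
  moreover have "((- 6 * (rho x)\<^sup>2 - 8 * om * rho x + 2 * e2) * (2 * R x) - rho1 x * (2 * R1 x)) / (2 * R x)\<^sup>2
     = (- 3 * R x ^ 4 - 4 * om * (R x)\<^sup>2 + e2 - (R1 x)\<^sup>2) / R x"
    unfolding rho1_eq rho_eq using R_pos[of x] by (simp add: field_simps eval_nat_numeral)
  moreover have "\<dots> = R2 x"
    unfolding R1_sq R2_def using R_pos[of x] by (simp add: field_simps eval_nat_numeral)
  ultimately show ?thesis by simp
qed

text \<open>This is M R' = 0, the infinitesimal translation invariance: \<open>2 * W x\<close> is
  the derivative in R of the right-hand side of the profile equation.\<close>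

lemma R2_deriv: "(R2 has_real_derivative 2 * W x * R1 x) (at x)"
  unfolding R2_def[abs_def] W_def rho_eq using R_pos[of x]
  by (auto intro!: derivative_eq_intros R_deriv simp: field_simps eval_nat_numeral)

lemma dn_sq_bounds_strict:
  assumes "0 < x" "x < KK"
  shows "1 - k\<^sup>2 < (dn x)\<^sup>2" "(dn x)\<^sup>2 < 1"
proof -
  have *: "0 < (sin (am x))\<^sup>2" "0 < (cos (am x))\<^sup>2" using sin_cos_am_pos[OF assms] by auto
  have "(sin (am x))\<^sup>2 < 1" using *(2) by (simp add: sin_squared_eq)
  then show "1 - k\<^sup>2 < (dn x)\<^sup>2" using k2_bounds by (simp add: dn_sq)
  show "(dn x)\<^sup>2 < 1" using * k2_bounds by (simp add: dn_sq)
qed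

lemma continuous_rho: "continuous_on A rho"
  using rho_deriv by (intro continuous_at_imp_continuous_on) (auto intro: DERIV_isCont)

section \<open>The mean of R^2\<close>

definition rho_prim :: "real \<Rightarrow> real" where "rho_prim x = (LBINT y=ereal 0..ereal x. rho y)"

lemma rho_prim_0: "rho_prim 0 = 0" by (simp add: rho_prim_def)

lemma rho_prim_deriv: "(rho_prim has_real_derivative rho x) (at x)"
  unfolding rho_prim_def[abs_def] by (rule has_real_derivative_LBINT) (rule continuous_rho)

definition beta :: real where "beta = rho_prim KK / KK"

lemma rho_prim_KK: "rho_prim KK = beta * KK" using KK_pos by (simp add: beta_def)

text \<open>Here \<open>\<epsilon>\<close> is the mean of dn^2. As k^2 sn cn / dn vanishes at 0 and
  \<open>KK\<close> and has derivative dn^2 - k'^2 / dn^2, the means of dn^2 and k'^2 / dn^2 agree,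
  and \<open>2 * \<epsilon>\<close> is the mean of their sum. That sum is at least 2k' and, inside
  the interval, less than 1 + k'^2; averaging gives bounds for \<open>\<epsilon>\<close> on both
  sides.\<close>

lemma beta_bounds:
  shows "0 < beta" and "2 * beta < b + (b - k\<^sup>2)" and "b * (b - k\<^sup>2) < beta\<^sup>2"
proof -
  define k' where "k' = sqrt (1 - k\<^sup>2)"
  have k': "0 < k'" "k'\<^sup>2 = 1 - k\<^sup>2" using k2_bounds by (auto simp: k'_def)
  define \<epsilon> where "\<epsilon> = beta - (b - 1)"
  define F where "F x = 2 * (rho_prim x - (b - 1) * x) - k\<^sup>2 * (sin (am x) * cos (am x) / dn x)" for x
  have F_deriv: "(F has_real_derivative (dn x)\<^sup>2 + k'\<^sup>2 / (dn x)\<^sup>2) (at x)" for x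
  proof -
    define S where "S = (sin (am x))\<^sup>2"
    have c: "(cos (am x))\<^sup>2 = 1 - S" by (simp add: S_def cos_squared_eq)
    have d: "(dn x)\<^sup>2 = 1 - k\<^sup>2 * S" by (simp add: dn_sq S_def)
    have "(F has_real_derivative 2 * (rho x - (b - 1))
        - k\<^sup>2 * (((cos (am x))\<^sup>2 - (sin (am x))\<^sup>2) * (dn x)\<^sup>2
          + k\<^sup>2 * (sin (am x))\<^sup>2 * (cos (am x))\<^sup>2) / (dn x)\<^sup>2) (at x)"
      unfolding F_def[abs_def] using dn_pos[of x]
      by (auto intro!: derivative_eq_intros am_deriv dn_deriv rho_prim_deriv simp: field_simps power2_eq_square)
    moreover have "2 * (rho x - (b - 1))
        - k\<^sup>2 * (((cos (am x))\<^sup>2 - (sin (am x))\<^sup>2) * (dn x)\<^sup>2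
          + k\<^sup>2 * (sin (am x))\<^sup>2 * (cos (am x))\<^sup>2) / (dn x)\<^sup>2 = (dn x)\<^sup>2 + k'\<^sup>2 / (dn x)\<^sup>2"
    proof -
      have "0 < 1 - k\<^sup>2 * S" using dn_pos[of x] d by (metis zero_less_power)
      then show ?thesis
        unfolding d c S_def[symmetric] k' rho_def by (simp add: field_simps power2_eq_square)
    qed
    ultimately show ?thesis by simp
  qed
  have F0: "F 0 = 0" by (simp add: F_def rho_prim_0 am_0)
  have FK: "F KK = 2 * \<epsilon> * KK" by (simp add: F_def rho_prim_KK am_KK \<epsilon>_def algebra_simps)
  have "F 0 - 2 * k' * 0 \<le> F KK - 2 * k' * KK"
  proof (rule DERIV_nonneg_imp_nondecreasing[where f = "\<lambda>x. F x - 2 * k' * x"])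
    fix x
    have "(dn x)\<^sup>2 + k'\<^sup>2 / (dn x)\<^sup>2 - 2 * k' = (dn x - k' / dn x)\<^sup>2"
      using dn_pos[of x] by (simp add: field_simps power2_eq_square)
    then have "0 \<le> (dn x)\<^sup>2 + k'\<^sup>2 / (dn x)\<^sup>2 - 2 * k'" by simp
    moreover have "((\<lambda>x. F x - 2 * k' * x) has_real_derivative (dn x)\<^sup>2 + k'\<^sup>2 / (dn x)\<^sup>2 - 2 * k') (at x)"
      by (auto intro!: derivative_eq_intros F_deriv)
    ultimately show "\<exists>y. ((\<lambda>x. F x - 2 * k' * x) has_real_derivative y) (at x) \<and> 0 \<le> y" by blast
  qed (use KK_pos in simp)
  then have e1: "k' \<le> \<epsilon>" using KK_pos by (simp add: F0 FK)
  have "(2 - k\<^sup>2) * 0 - F 0 < (2 - k\<^sup>2) * KK - F KK"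
  proof (rule DERIV_pos_imp_increasing_open[where f = "\<lambda>x. (2 - k\<^sup>2) * x - F x"])
    fix x assume x: "0 < x" "x < KK"
    have "0 < (1 - (dn x)\<^sup>2) * ((dn x)\<^sup>2 - k'\<^sup>2) / (dn x)\<^sup>2"
      using dn_sq_bounds_strict[OF x] dn_pos[of x] k' by simp
    also have "\<dots> = (2 - k\<^sup>2) - ((dn x)\<^sup>2 + k'\<^sup>2 / (dn x)\<^sup>2)"
      unfolding k'(2) using dn_pos[of x] by (simp add: field_simps power2_eq_square)
    finally have "0 < (2 - k\<^sup>2) - ((dn x)\<^sup>2 + k'\<^sup>2 / (dn x)\<^sup>2)" .
    moreover have "((\<lambda>x. (2 - k\<^sup>2) * x - F x) has_real_derivative (2 - k\<^sup>2) - ((dn x)\<^sup>2 + k'\<^sup>2 / (dn x)\<^sup>2)) (at x)"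
      by (auto intro!: derivative_eq_intros F_deriv)
    ultimately show "\<exists>y. ((\<lambda>x. (2 - k\<^sup>2) * x - F x) has_real_derivative y) (at x) \<and> 0 < y" by blast
  next
    show "continuous_on {0..KK} (\<lambda>x. (2 - k\<^sup>2) * x - F x)"
      using F_deriv by (intro continuous_intros continuous_at_imp_continuous_on) (auto intro: DERIV_isCont)
  qed (use KK_pos in simp)
  then have e2: "2 * \<epsilon> < 2 - k\<^sup>2"
    using KK_pos by (simp add: F0 FK flip: mult.assoc)
  show "2 * beta < b + (b - k\<^sup>2)" using e2 by (simp add: \<epsilon>_def)
  \<comment> \<open>With \<open>beta\<close> written as \<open>\<epsilon> - (1 - b)\<close>, the
    required difference splits into two terms, each controlled by one of the bounds on
    \<open>\<epsilon>\<close>.\<close>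
  have "k'\<^sup>2 \<le> \<epsilon>\<^sup>2" using e1 k' by (intro power_mono) auto
  moreover have "0 < (1 - b) * (2 - k\<^sup>2 - 2 * \<epsilon>)" using e2 b1 by simp
  moreover have "beta\<^sup>2 - b * (b - k\<^sup>2) = \<epsilon>\<^sup>2 - k'\<^sup>2 + (1 - b) * (2 - k\<^sup>2 - 2 * \<epsilon>)"
    unfolding k'(2) by (simp add: \<epsilon>_def algebra_simps power2_eq_square)
  ultimately show "b * (b - k\<^sup>2) < beta\<^sup>2" by linarith
  have "0 < rho_prim KK"
    using DERIV_pos_imp_increasing[of 0 KK rho_prim] rho_prim_deriv rho_pos KK_pos rho_prim_0 by metis
  then show "0 < beta" using KK_pos by (simp add: beta_def)
qed

lemma continuous_R: "continuous_on A R"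
  using R_deriv by (intro continuous_at_imp_continuous_on) (auto intro: DERIV_isCont)

lemma continuous_R1: "continuous_on A R1"
  using R1_deriv by (intro continuous_at_imp_continuous_on) (auto intro: DERIV_isCont)

lemma continuous_W: "continuous_on A W"
  unfolding W_def[abs_def] using rho_pos
  by (intro continuous_intros continuous_rho) (auto simp: less_imp_neq[symmetric])

section \<open>Nonnegativity of the energy under the constraints\<close>

lemma R_R2: "R x * R2 x = - 3 * (rho x)\<^sup>2 - 4 * om * rho x + e2 - (R1 x)\<^sup>2"
  unfolding R1_sq R2_def rho_eq using R_pos[of x] by (simp add: field_simps eval_nat_numeral)

lemma R1_0: "R1 0 = 0" and R1_KK: "R1 KK = 0"
  by (simp_all add: R1_def rho1_0 rho1_KK)

text \<open>In terms of the roots the value is -(r1 - r2)(r1 - r3), and at \<open>KK\<close> it is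
  (r1 - r2)(r2 - r3). Neither is zero, so R' has simple zeros at both ends.\<close>

lemma R_R2_0: "R 0 * R2 0 = - k\<^sup>2"
  unfolding R_R2 rho_0 R1_0 om_eq e2_def by (simp add: field_simps power2_eq_square)

lemma R_R2_KK: "R KK * R2 KK = k\<^sup>2 * (1 - k\<^sup>2)"
  unfolding R_R2 rho_KK R1_KK om_eq e2_def by (simp add: field_simps power2_eq_square)

text \<open>R' solves M R' = 0 and has no zero inside the interval. Twice the integrand is therefore
  the square of u' - (R''/R') u plus the derivative of (R''/R') u^2. The boundary terms vanish since
  \<open>u\<close> is zero at the ends, where R' has only simple zeros.\<close>

lemma dirichlet_nonneg:
  assumes u: "\<And>x. (u has_real_derivative u1 x) (at x)" and u1: "continuous_on {0..KK} u1"
    and "u 0 = 0" "u KK = 0"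
  shows "0 \<le> integral {0..KK} (\<lambda>x. (u1 x)\<^sup>2 / 2 + W x * (u x)\<^sup>2)"
proof -
  define g where "g x = R2 x * ((u x)\<^sup>2 / R1 x)" for x
  define f where "f x = (u1 x)\<^sup>2 + 2 * W x * (u x)\<^sup>2" for x
  have R1_neg: "R1 x < 0" if "0 < x" "x < KK" for x
    using rho1_neg[OF that] R_pos[of x] by (simp add: R1_def divide_neg_pos)
  have "R2 0 \<noteq> 0" "R2 KK \<noteq> 0" using R_R2_0 R_R2_KK k2_bounds by auto
  then have ends: "isCont (\<lambda>x. (u x)\<^sup>2 / R1 x) 0" "isCont (\<lambda>x. (u x)\<^sup>2 / R1 x) KK"
    using assms R1_0 R1_KK by (auto intro!: isCont_square_over_zero[OF u R1_deriv])
  have cont: "isCont g x" if "0 \<le> x" "x \<le> KK" for x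
  proof -
    have "isCont (\<lambda>x. (u x)\<^sup>2 / R1 x) x"
    proof (cases "x = 0 \<or> x = KK")
      case False
      then have "R1 x \<noteq> 0" using that R1_neg[of x] by auto
      then show ?thesis
        by (intro continuous_intros DERIV_isCont[OF R1_deriv] DERIV_isCont[OF u])
    qed (use ends in auto)
    then show ?thesis
      unfolding g_def[abs_def] by (intro continuous_mult DERIV_isCont[OF R2_deriv])
  qed
  have "((\<lambda>x. f x - (u1 x - R2 x / R1 x * u x)\<^sup>2) has_integral g KK - g 0) {0..KK}"
  proof (rule fundamental_theorem_of_calculus_interior)
    show "continuous_on {0..KK} g" by (intro continuous_at_imp_continuous_on) (auto intro: cont)
    fix x assume x: "x \<in> {0<..<KK}"
    have "(g has_real_derivative f x - (u1 x - R2 x / R1 x * u x)\<^sup>2) (at x)"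
      unfolding g_def[abs_def] f_def using R1_neg[of x] x
      by (auto intro!: derivative_eq_intros u R1_deriv R2_deriv simp: field_simps power2_eq_square)
    then show "(g has_vector_derivative f x - (u1 x - R2 x / R1 x * u x)\<^sup>2) (at x)"
      by (simp add: has_real_derivative_iff_has_vector_derivative)
  qed (use KK_pos in simp)
  then have "((\<lambda>x. f x - (u1 x - R2 x / R1 x * u x)\<^sup>2) has_integral 0) {0..KK}"
    by (simp add: g_def assms)
  moreover have "continuous_on {0..KK} f"
    unfolding f_def[abs_def] using u
    by (intro continuous_intros u1 continuous_W continuous_at_imp_continuous_on) (auto intro: DERIV_isCont)
  then have "(f has_integral integral {0..KK} f) {0..KK}"
    using integrable_continuous_real by blast
  ultimately have "0 \<le> integral {0..KK} f"
    by (rule has_integral_le) simp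
  moreover have "integral {0..KK} (\<lambda>x. (u1 x)\<^sup>2 / 2 + W x * (u x)\<^sup>2) = integral {0..KK} (\<lambda>x. 1 / 2 * f x)"
    by (simp add: f_def algebra_simps)
  ultimately show ?thesis by simp
qed

lemma om_roots: "om = - (b + (b - k\<^sup>2) + (b - 1)) / 2" by (simp add: om_eq field_simps)

lemma cc_sq_roots: "cc\<^sup>2 = - b * (b - k\<^sup>2) * (b - 1)" by (simp add: cc_sq algebra_simps)

text \<open>At a critical point of the profile \<open>rho\<close> is a root of the cubic; this
  evaluates the mode R^3 + 2 om R at the two ends.\<close>

lemma cubic_root:
  assumes "rho1 x = 0" shows "(rho x)\<^sup>2 + 2 * om * rho x = e2 - cc\<^sup>2 / rho x"
proof -
  have "0 = - 4 * rho x ^ 3 - 8 * om * (rho x)\<^sup>2 + 4 * e2 * rho x - 4 * cc\<^sup>2"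
    using rho1_sq[of x] assms by simp
  then show ?thesis using rho_pos[of x] by (simp add: field_simps eval_nat_numeral)
qed

section \<open>Extremals with prescribed boundary values\<close>

text \<open>
  The extremals are combinations of $1/R$, of the derivative $R + xR'$ of the scaling family,
  of $R^3 - R'\int_0^x R^2 + 2\omega R$ and of the translation mode $R'$; all of them satisfy $MU = gR - cq/R^3$.
\<close>

lemma extremal_exists:
  assumes "(u0, uK) \<noteq> (0, 0)"
  obtains u u1 psi psi1 g p q where
    "\<And>x. (u has_real_derivative u1 x) (at x)"
    "\<And>x. (u1 has_real_derivative 2 * (W x * u x - g * R x + cc * q / R x ^ 3)) (at x)"
    "\<And>x. (psi has_real_derivative psi1 x) (at x)"
    "\<And>x. R x * psi1 x + 2 * cc * u x / rho x = p * R x + q / R x"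
    "u 0 = u0" "u KK = uK" "psi 0 = 0" "psi KK = 0"
    "((\<lambda>x. u x * R x) has_integral 0) {0..KK}"
    "((\<lambda>x. R x * (p * R x + q / R x)) has_integral 0) {0..KK}"
    "0 < u1 KK * uK - u1 0 * u0"
proof -
  obtain a1 a2 a3 n1 n2 p q where
    cq: "cc * q = e2 * a1 + 4 * om * cc\<^sup>2 * a2 + 3 * cc\<^sup>2 * a3" and
    a3: "a3 = n2 - n1 + a2 * beta" and pb: "p * beta = - q" and
    c1: "a1 + a2 * e2 / 2 + a3 * beta / 2 + (n2 * (b - k\<^sup>2) - n1 * b) / 2 = 0" and
    ps: "- a1 * beta - a2 * cc\<^sup>2 + cc\<^sup>2 * (n2 / (b - k\<^sup>2) - n1 / b) + cc * p = 0" and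
    U0: "a1 + a2 * (e2 - cc\<^sup>2 / b) + a3 * b = R 0 * u0" and
    UK: "a1 + a2 * (e2 - cc\<^sup>2 / (b - k\<^sup>2)) + a3 * (b - k\<^sup>2) = R KK * uK" and
    pos: "0 < n1 * (b - (b - 1)) / b * (R 0 * u0) + n2 * ((b - k\<^sup>2) - (b - 1)) / (b - k\<^sup>2) * (R KK * uK)"
  proof -
    have nz: "(R 0 * u0, R KK * uK) \<noteq> (0, 0)" using assms R_pos[of 0] R_pos[of KK] by simp
    have "b - k\<^sup>2 < b" "0 < b - k\<^sup>2" "b - 1 < 0" using k2_bounds bk b1 by auto
    note extremal_parameters[OF this cc_pos cc_sq_roots om_roots e2_def beta_bounds nz]
    then show ?thesis by (elim exE conjE) (rule that)
  qed
  \<comment> \<open>With this choice the derivative of \<open>u\<close> is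
    \<open>KK * n1 * R2 0\<close> at 0 and, by the relation for \<open>a3\<close>,
    \<open>KK * n2 * R2 KK\<close> at \<open>KK\<close>. The common factor \<open>KK\<close> then
    drops out of the conditions.\<close>
  define nu where "nu = KK * n1"
  define u where "u x = a1 / R x + a2 * (R x ^ 3 - R1 x * rho_prim x + 2 * om * R x)
     + a3 * (R x + x * R1 x) + nu * R1 x" for x
  define u1 where "u1 x = - a1 * R1 x / (R x)\<^sup>2 + a2 * (2 * (R x)\<^sup>2 * R1 x - R2 x * rho_prim x + 2 * om * R1 x)
     + a3 * (2 * R1 x + x * R2 x) + nu * R2 x" for x
  \<comment> \<open>Obtained by solving the flux equation for psi' mode by mode and integrating. The
    translation mode contributes \<open>cc / rho x\<close>; subtracting \<open>cc / b\<close> makes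
    \<open>psi\<close> vanish at 0.\<close>
  define psi where "psi x = - a1 * (R1 x / R x + rho_prim x) / cc - a2 * cc * (x + rho_prim x / rho x)
     + a3 * cc * x / rho x + nu * (cc / rho x - cc / b) + p * x" for x
  define psi1 where "psi1 x = - a1 * (R2 x / R x - (R1 x)\<^sup>2 / (R x)\<^sup>2 + rho x) / cc
     - a2 * cc * (2 - rho_prim x * rho1 x / (rho x)\<^sup>2)
     + a3 * cc * (1 / rho x - x * rho1 x / (rho x)\<^sup>2) - nu * cc * rho1 x / (rho x)\<^sup>2 + p" for x
  define g where "g = - 3 * a1 - 2 * e2 * a2 + 2 * om * a3"
  have R0: "R x \<noteq> 0" for x using R_pos[of x] by simp
  have rho0: "rho x \<noteq> 0" for x using rho_pos[of x] by simp
  have 1: "(u has_real_derivative u1 x) (at x)" for x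
    unfolding u_def[abs_def] u1_def using R0[of x]
    by (auto intro!: derivative_eq_intros R_deriv R1_deriv rho_prim_deriv simp: rho_eq field_simps eval_nat_numeral)
  have 2: "(u1 has_real_derivative 2 * (W x * u x - g * R x + cc * q / R x ^ 3)) (at x)" for x
  proof -
    have D: "(u1 has_real_derivative a1 * (- R2 x / (R x)\<^sup>2 + 2 * (R1 x)\<^sup>2 / R x ^ 3)
      + a2 * (4 * R x * (R1 x)\<^sup>2 + 2 * (R x)\<^sup>2 * R2 x - R2 x * rho x + 2 * om * R2 x - 2 * W x * R1 x * rho_prim x)
      + a3 * (3 * R2 x + x * (2 * W x * R1 x)) + nu * (2 * W x * R1 x)) (at x)"
      unfolding u1_def[abs_def] using R0[of x]
      by (auto intro!: derivative_eq_intros R_deriv R1_deriv R2_deriv rho_prim_deriv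
          simp: field_simps eval_nat_numeral)
    \<comment> \<open>The next three identities remove R'' and R'^2 from the second derivatives of
      the modes other than R'. Beyond the terms with \<open>W\<close> only multiples of R and 1 /
      R^3 remain, and these are collected in \<open>g\<close> and \<open>q\<close>.\<close>
    have E1: "- R2 x / (R x)\<^sup>2 + 2 * (R1 x)\<^sup>2 / R x ^ 3 = 2 * W x / R x + 6 * R x + 2 * e2 / R x ^ 3"
      unfolding R1_sq R2_def W_def rho_eq using R0[of x] by (simp add: field_simps eval_nat_numeral)
    have E2: "4 * R x * (R1 x)\<^sup>2 + 2 * (R x)\<^sup>2 * R2 x - R2 x * rho x + 2 * om * R2 x
       = 2 * W x * (R x ^ 3 + 2 * om * R x) + 4 * e2 * R x + 8 * om * cc\<^sup>2 / R x ^ 3"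
      unfolding R1_sq R2_def W_def rho_eq using R0[of x] by (simp add: field_simps eval_nat_numeral)
    have E3: "3 * R2 x = 2 * W x * R x - 4 * om * R x + 6 * cc\<^sup>2 / R x ^ 3"
      unfolding R2_def W_def rho_eq using R0[of x] by (simp add: field_simps eval_nat_numeral)
    have T: "2 * (W x * u x - g * R x + cc * q / R x ^ 3) =
        a1 * (2 * W x / R x + 6 * R x + 2 * e2 / R x ^ 3)
      + a2 * (2 * W x * (R x ^ 3 + 2 * om * R x) + 4 * e2 * R x + 8 * om * cc\<^sup>2 / R x ^ 3 - 2 * W x * R1 x * rho_prim x)
      + a3 * (2 * W x * R x - 4 * om * R x + 6 * cc\<^sup>2 / R x ^ 3 + x * (2 * W x * R1 x)) + nu * (2 * W x * R1 x)"
      unfolding cq g_def u_def using R0[of x] by (simp add: field_simps)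
    show ?thesis using D by (simp only: E1 E2 E3 T)
  qed
  have 3: "(psi has_real_derivative psi1 x) (at x)" for x
    unfolding psi_def[abs_def] psi1_def using R0[of x] rho0[of x] cc_pos
    by (auto intro!: derivative_eq_intros R_deriv R1_deriv rho_prim_deriv rho_deriv
        simp: field_simps power2_eq_square)
  have 4: "R x * psi1 x + 2 * cc * u x / rho x = p * R x + q / R x" for x
  proof -
    have E: "- (R2 x - (R1 x)\<^sup>2 / R x + R x ^ 3) / cc + 2 * cc / R x ^ 3 = e2 / (cc * R x)"
      unfolding R1_sq R2_def using R0[of x] cc_pos by (simp add: field_simps eval_nat_numeral)
    have T: "R x * psi1 x + 2 * cc * u x / rho x =
      a1 * (- (R2 x - (R1 x)\<^sup>2 / R x + R x ^ 3) / cc + 2 * cc / R x ^ 3)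
      + a2 * (4 * om * cc / R x) + a3 * (3 * cc / R x) + p * R x"
      unfolding psi1_def u_def rho_eq rho1_eq using R0[of x] cc_pos
      by (simp add: field_simps eval_nat_numeral)
    have q: "q = (e2 * a1 + 4 * om * cc\<^sup>2 * a2 + 3 * cc\<^sup>2 * a3) / cc"
      using cq cc_pos by (simp add: field_simps)
    show ?thesis unfolding T E q using R0[of x] cc_pos by (simp add: field_simps power2_eq_square)
  qed
  have Ru: "R x * u x = a1 + a2 * ((rho x)\<^sup>2 + 2 * om * rho x) + a3 * rho x" if "R1 x = 0" for x
    unfolding u_def that rho_eq using R0[of x] by (simp add: field_simps eval_nat_numeral)
  have ends: "R 0 * u 0 = a1 + a2 * (e2 - cc\<^sup>2 / b) + a3 * b"
    "R KK * u KK = a1 + a2 * (e2 - cc\<^sup>2 / (b - k\<^sup>2)) + a3 * (b - k\<^sup>2)"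
    unfolding Ru[OF R1_0] Ru[OF R1_KK] cubic_root[OF rho1_0] cubic_root[OF rho1_KK]
    unfolding rho_0 rho_KK by (simp_all only:)
  have 5: "u 0 = u0" "u KK = uK" using ends U0 UK R0 by auto
  have 6: "psi 0 = 0" by (simp add: psi_def R1_0 rho_0 rho_prim_0)
  have 7: "psi KK = 0"
  proof -
    define r where "r = b - k\<^sup>2"
    have r: "r \<noteq> 0" using bk by (simp add: r_def)
    have "cc * psi KK = KK * (- a1 * beta - a2 * cc\<^sup>2 + cc\<^sup>2 * (n2 / (b - k\<^sup>2) - n1 / b) + cc * p)"
      unfolding psi_def R1_KK rho_KK rho_prim_KK nu_def a3 r_def[symmetric] using cc_pos r b_pos
      by (simp add: field_simps power2_eq_square)
    then show ?thesis using ps cc_pos by simp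
  qed
  have 8: "((\<lambda>x. u x * R x) has_integral 0) {0..KK}"
  proof -
    define F where "F x = a1 * x + a2 * (e2 / 2 * x - rho x * rho_prim x / 2 - rho1 x / 4)
      + a3 * (x * rho x / 2 + rho_prim x / 2) + nu * rho x / 2" for x
    have "(F has_real_derivative a1 + a2 * (e2 / 2 - rho1 x * rho_prim x / 2 - rho x * rho x / 2
       - (- 6 * (rho x)\<^sup>2 - 8 * om * rho x + 2 * e2) / 4) + a3 * (rho x + x * rho1 x / 2) + nu * rho1 x / 2) (at x)" for x
      unfolding F_def[abs_def]
      by (auto intro!: derivative_eq_intros rho_prim_deriv rho_deriv rho1_deriv simp: field_simps)
    moreover have "a1 + a2 * (e2 / 2 - rho1 x * rho_prim x / 2 - rho x * rho x / 2
       - (- 6 * (rho x)\<^sup>2 - 8 * om * rho x + 2 * e2) / 4) + a3 * (rho x + x * rho1 x / 2) + nu * rho1 x / 2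
       = u x * R x" for x
      unfolding u_def rho_eq rho1_eq using R0[of x] by (simp add: field_simps eval_nat_numeral)
    ultimately have "(F has_real_derivative u x * R x) (at x)" for x by simp
    then have "((\<lambda>x. u x * R x) has_integral F KK - F 0) {0..KK}"
      using KK_pos by (intro has_integral_derivative) auto
    moreover have "F KK - F 0 = KK * (a1 + a2 * e2 / 2 + a3 * beta / 2 + (n2 * (b - k\<^sup>2) - n1 * b) / 2)"
      unfolding F_def rho_0 rho_KK rho1_0 rho1_KK rho_prim_0 rho_prim_KK nu_def a3 by (simp add: field_simps)
    ultimately show ?thesis using c1 by simp
  qed
  have 9: "((\<lambda>x. R x * (p * R x + q / R x)) has_integral 0) {0..KK}"
  proof -
    have "((\<lambda>x. p * rho_prim x + q * x) has_real_derivative p * rho x + q) (at x)" for x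
      by (auto intro!: derivative_eq_intros rho_prim_deriv)
    then have "((\<lambda>x. p * rho x + q) has_integral (p * rho_prim KK + q * KK) - (p * rho_prim 0 + q * 0)) {0..KK}"
      using KK_pos by (intro has_integral_derivative) auto
    moreover have "p * rho_prim KK + q * KK = KK * (p * beta + q)" by (simp add: rho_prim_KK algebra_simps)
    moreover have "(\<lambda>x. R x * (p * R x + q / R x)) = (\<lambda>x. p * rho x + q)"
      using R0 by (auto simp: rho_eq field_simps)
    ultimately show ?thesis by (simp add: pb rho_prim_0)
  qed
  have 10: "0 < u1 KK * uK - u1 0 * u0"
  proof -
    have "R2 KK = k\<^sup>2 * (1 - k\<^sup>2) / R KK" "R2 0 = - k\<^sup>2 / R 0"
      using R_R2_0 R_R2_KK R0[of 0] R0[of KK] by (simp_all add: field_simps)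
    moreover have "u1 KK = KK * n2 * R2 KK" "u1 0 = KK * n1 * R2 0"
      by (simp_all add: u1_def R1_KK R1_0 rho_prim_0 rho_prim_KK nu_def a3 algebra_simps)
    ultimately have u1: "u1 KK = KK * n2 * (k\<^sup>2 * (1 - k\<^sup>2) / R KK)" "u1 0 = KK * n1 * (- k\<^sup>2 / R 0)"
      by simp_all
    \<comment> \<open>The gaps b - (b - 1) and (b - k^2) - (b - 1) are 1 and 1 - k^2, so the end
      values of R'' produce the quadratic form already known to be positive, times
      \<open>KK * k\<^sup>2\<close>.\<close>
    have "u1 KK * uK - u1 0 * u0 = KK * k\<^sup>2 * (n1 * (b - (b - 1)) / (R 0 * R 0) * (R 0 * u0)
       + n2 * ((b - k\<^sup>2) - (b - 1)) / (R KK * R KK) * (R KK * uK))"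
      unfolding u1 using R0[of 0] R0[of KK] by (simp add: field_simps)
    also have "\<dots> = KK * k\<^sup>2 * (n1 * (b - (b - 1)) / b * (R 0 * u0)
       + n2 * ((b - k\<^sup>2) - (b - 1)) / (b - k\<^sup>2) * (R KK * uK))"
      using rho_eq[of 0] rho_eq[of KK] by (simp add: rho_0 rho_KK)
    also have "\<dots> > 0" using pos KK_pos k2_bounds by (intro mult_pos_pos) auto
    finally show ?thesis .
  qed
  show ?thesis using that 1 2 3 4 5 6 7 8 9 10 by blast
qed

section \<open>Flux and energy on the half and full period\<close>

definition flux :: "(real \<Rightarrow> real) \<Rightarrow> (real \<Rightarrow> real) \<Rightarrow> real \<Rightarrow> real" where
  "flux u psi1 x = R x * psi1 x + 2 * cc * u x / rho x"

text \<open>The density of Q. Derivatives are separate arguments, so differences and parity parts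
  can be inserted directly.\<close>

definition energy_dens :: "(real \<Rightarrow> real) \<Rightarrow> (real \<Rightarrow> real) \<Rightarrow> (real \<Rightarrow> real) \<Rightarrow> real \<Rightarrow> real" where
  "energy_dens u u1 psi1 x = (flux u psi1 x)\<^sup>2 / 2 + ((u1 x)\<^sup>2 / 2 + W x * (u x)\<^sup>2)"

lemma continuous_flux:
  assumes "continuous_on A u" "continuous_on A psi1"
  shows "continuous_on A (flux u psi1)"
  unfolding flux_def[abs_def] using assms rho_pos
  by (intro continuous_intros continuous_R continuous_rho) (auto simp: less_imp_neq[symmetric])

lemma continuous_energy_dens:
  assumes "continuous_on A u" "continuous_on A u1" "continuous_on A psi1"
  shows "continuous_on A (energy_dens u u1 psi1)"
  unfolding energy_dens_def[abs_def] using assms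
  by (intro continuous_intros continuous_flux continuous_W) auto

lemma dirichlet_bound:
  assumes u: "\<And>x. (u has_real_derivative u1 x) (at x)"
    and cont: "continuous_on {0..KK} u1" "continuous_on {0..KK} psi1"
    and "u 0 = 0" "u KK = 0"
  shows "integral {0..KK} (\<lambda>x. (flux u psi1 x)\<^sup>2) / 2 \<le> integral {0..KK} (energy_dens u u1 psi1)"
proof -
  have c: "continuous_on {0..KK} u" using u by (intro continuous_at_imp_continuous_on) (auto intro: DERIV_isCont)
  have "integral {0..KK} (energy_dens u u1 psi1) = integral {0..KK} (\<lambda>x. (flux u psi1 x)\<^sup>2 / 2)
     + integral {0..KK} (\<lambda>x. (u1 x)\<^sup>2 / 2 + W x * (u x)\<^sup>2)"
    unfolding energy_dens_def[abs_def] using c cont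
    by (intro integral_add integrable_continuous_real continuous_intros continuous_flux continuous_W) auto
  then show ?thesis using dirichlet_nonneg[OF u cont(1)] assms by simp
qed

lemma integral_flux_sq:
  assumes "continuous_on {0..KK} u" "continuous_on {0..KK} psi1"
  shows "0 \<le> integral {0..KK} (\<lambda>x. (flux u psi1 x)\<^sup>2)"
    and "integral {0..KK} (\<lambda>x. (flux u psi1 x)\<^sup>2) = 0 \<Longrightarrow> x \<in> {0..KK} \<Longrightarrow> flux u psi1 x = 0"
proof -
  have c: "continuous_on {0..KK} (\<lambda>x. (flux u psi1 x)\<^sup>2)"
    using assms by (intro continuous_intros continuous_flux)
  then show "0 \<le> integral {0..KK} (\<lambda>x. (flux u psi1 x)\<^sup>2)"
    by (intro integral_nonneg integrable_continuous_real) auto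
  assume "integral {0..KK} (\<lambda>x. (flux u psi1 x)\<^sup>2) = 0" "x \<in> {0..KK}"
  then show "flux u psi1 x = 0"
    using integral_eq_0_iff[OF c KK_pos] by auto
qed

text \<open>First variation of the energy at an extremal with flux \<open>p * R x + q / R x\<close>.
  After integration by parts, the terms with \<open>g\<close> and \<open>p\<close> vanish by the two
  constraints and the term with \<open>q\<close> by the end values of \<open>psi\<close>; only
  boundary values survive.\<close>

lemma polar_integral:
  assumes e1: "\<And>x. (e1 has_real_derivative 2 * (W x * e x - g * R x + cc * q / R x ^ 3)) (at x)"
    and u: "\<And>x. (u has_real_derivative u1 x) (at x)"
    and psi: "\<And>x. (psi has_real_derivative psi1 x) (at x)" and "psi 0 = 0" "psi KK = 0"
    and c1: "((\<lambda>x. u x * R x) has_integral 0) {0..KK}"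
    and c2: "((\<lambda>x. R x * flux u psi1 x) has_integral 0) {0..KK}"
  shows "((\<lambda>x. (p * R x + q / R x) * flux u psi1 x / 2 + (e1 x * u1 x / 2 + W x * e x * u x))
     has_integral (e1 KK * u KK - e1 0 * u 0) / 2) {0..KK}"
proof -
  define F where "F x = e1 x * u x / 2 + q * psi x / 2" for x
  have "(F has_real_derivative (W x * e x - g * R x + cc * q / R x ^ 3) * u x + e1 x * u1 x / 2 + q * psi1 x / 2) (at x)" for x
    unfolding F_def[abs_def] by (auto intro!: derivative_eq_intros e1 u psi)
  then have "((\<lambda>x. (W x * e x - g * R x + cc * q / R x ^ 3) * u x + e1 x * u1 x / 2 + q * psi1 x / 2)
      has_integral F KK - F 0) {0..KK}"
    using KK_pos by (intro has_integral_derivative) auto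
  from has_integral_add[OF has_integral_add[OF this has_integral_mult_right[OF c1, of g]]
     has_integral_mult_right[OF c2, of "p / 2"]]
  have I: "((\<lambda>x. (W x * e x - g * R x + cc * q / R x ^ 3) * u x + e1 x * u1 x / 2 + q * psi1 x / 2
      + g * (u x * R x) + p / 2 * (R x * flux u psi1 x)) has_integral (e1 KK * u KK - e1 0 * u 0) / 2) {0..KK}"
    using assms(4,5) by (simp add: F_def diff_divide_distrib)
  have E: "(W x * e x - g * R x + cc * q / R x ^ 3) * u x + e1 x * u1 x / 2 + q * psi1 x / 2
      + g * (u x * R x) + p / 2 * (R x * flux u psi1 x) =
      (p * R x + q / R x) * flux u psi1 x / 2 + (e1 x * u1 x / 2 + W x * e x * u x)" for x
    unfolding flux_def rho_eq using R_pos[of x] by (simp add: field_simps power3_eq_cube)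
  show ?thesis using I by (simp only: E)
qed

text \<open>By \<open>polar_integral\<close>, the extremal with the boundary values of
  \<open>u\<close> pairs with \<open>u\<close> and with itself to the same number J > 0. Hence the
  energy of \<open>u\<close> is J plus that of the difference, which vanishes at both ends and is
  covered by \<open>dirichlet_bound\<close>.\<close>

lemma half_period_bound:
  assumes u: "\<And>x. (u has_real_derivative u1 x) (at x)"
    and psi: "\<And>x. (psi has_real_derivative psi1 x) (at x)" and "psi 0 = 0" "psi KK = 0"
    and cont: "continuous_on {0..KK} u1" "continuous_on {0..KK} psi1"
    and c1: "((\<lambda>x. u x * R x) has_integral 0) {0..KK}"
    and c2: "((\<lambda>x. R x * flux u psi1 x) has_integral 0) {0..KK}"
  shows "0 \<le> integral {0..KK} (energy_dens u u1 psi1)"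
    and "integral {0..KK} (energy_dens u u1 psi1) = 0 \<Longrightarrow> x \<in> {0..KK} \<Longrightarrow> flux u psi1 x = 0"
proof -
  have cu: "continuous_on {0..KK} u" using u by (intro continuous_at_imp_continuous_on) (auto intro: DERIV_isCont)
  \<comment> \<open>Zero boundary values lead to the first alternative, all others to strict
    positivity. If the energy is zero only the first is possible, and it forces the flux to
    vanish.\<close>
  have bound: "integral {0..KK} (\<lambda>x. (flux u psi1 x)\<^sup>2) / 2 \<le> integral {0..KK} (energy_dens u u1 psi1)
     \<or> 0 < integral {0..KK} (energy_dens u u1 psi1)"
  proof (cases "(u 0, u KK) = (0, 0)")
    case True
    then show ?thesis using dirichlet_bound[OF u cont] by simp
  next
    case False
    obtain e e1 f f1 g p q where
      e: "\<And>x. (e has_real_derivative e1 x) (at x)" and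
      e1: "\<And>x. (e1 has_real_derivative 2 * (W x * e x - g * R x + cc * q / R x ^ 3)) (at x)" and
      f: "\<And>x. (f has_real_derivative f1 x) (at x)" and
      he: "\<And>x. R x * f1 x + 2 * cc * e x / rho x = p * R x + q / R x" and
      ends: "e 0 = u 0" "e KK = u KK" "f 0 = 0" "f KK = 0" and
      ce1: "((\<lambda>x. e x * R x) has_integral 0) {0..KK}" and
      ce2: "((\<lambda>x. R x * (p * R x + q / R x)) has_integral 0) {0..KK}" and
      pos: "0 < e1 KK * u KK - e1 0 * u 0"
      by (rule extremal_exists[OF False]) (rule that)
    have hhe: "flux e f1 x = p * R x + q / R x" for x using he by (simp add: flux_def)
    define J where "J = (e1 KK * u KK - e1 0 * u 0) / 2"
    have Jw: "((\<lambda>x. (p * R x + q / R x) * flux u psi1 x / 2 + (e1 x * u1 x / 2 + W x * e x * u x))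
       has_integral J) {0..KK}"
      unfolding J_def by (rule polar_integral[OF e1 u psi assms(3,4) c1 c2])
    have Je: "((\<lambda>x. (p * R x + q / R x) * flux e f1 x / 2 + (e1 x * e1 x / 2 + W x * e x * e x))
       has_integral J) {0..KK}"
      unfolding J_def ends(1,2)[symmetric]
      by (rule polar_integral[OF e1 e f ends(3,4) ce1]) (use ce2 in \<open>simp add: hhe\<close>)
    have ce: "continuous_on {0..KK} e" "continuous_on {0..KK} e1"
      using e e1 by (auto intro!: continuous_at_imp_continuous_on intro: DERIV_isCont)
    \<comment> \<open>Solving the flux equation for \<open>f1\<close> supplies its
      continuity.\<close>
    have "f1 = (\<lambda>x. (p * R x + q / R x - 2 * cc * e x / rho x) / R x)"
    proof
      fix x show "f1 x = (p * R x + q / R x - 2 * cc * e x / rho x) / R x"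
        using he[of x] R_pos[of x] by (simp add: eq_divide_eq algebra_simps)
    qed
    moreover have "continuous_on {0..KK} (\<lambda>x. (p * R x + q / R x - 2 * cc * e x / rho x) / R x)"
      using R_pos rho_pos ce by (intro continuous_intros continuous_R continuous_rho)
        (auto simp: less_imp_neq[symmetric])
    ultimately have cf: "continuous_on {0..KK} f1" by simp
    define D where "D = integral {0..KK} (energy_dens u u1 psi1)"
    have "(energy_dens u u1 psi1 has_integral D) {0..KK}"
      unfolding D_def by (intro integrable_integral integrable_continuous_real continuous_energy_dens cu cont)
    from has_integral_add[OF has_integral_diff[OF this has_integral_mult_right[OF Jw, of 2]] Je]
    have "((\<lambda>x. energy_dens u u1 psi1 x - 2 * ((p * R x + q / R x) * flux u psi1 x / 2 + (e1 x * u1 x / 2 + W x * e x * u x))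
      + ((p * R x + q / R x) * flux e f1 x / 2 + (e1 x * e1 x / 2 + W x * e x * e x))) has_integral D - J) {0..KK}"
      by simp
    moreover have "energy_dens u u1 psi1 x - 2 * ((p * R x + q / R x) * flux u psi1 x / 2 + (e1 x * u1 x / 2 + W x * e x * u x))
      + ((p * R x + q / R x) * flux e f1 x / 2 + (e1 x * e1 x / 2 + W x * e x * e x))
      = energy_dens (\<lambda>x. u x - e x) (\<lambda>x. u1 x - e1 x) (\<lambda>x. psi1 x - f1 x) x" for x
    proof -
      have "flux (\<lambda>x. u x - e x) (\<lambda>x. psi1 x - f1 x) x = flux u psi1 x - flux e f1 x"
        by (simp add: flux_def algebra_simps diff_divide_distrib)
      note h = this
      show ?thesis unfolding energy_dens_def hhe[symmetric] h by (simp add: field_simps power2_eq_square)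
    qed
    ultimately have "integral {0..KK} (energy_dens (\<lambda>x. u x - e x) (\<lambda>x. u1 x - e1 x) (\<lambda>x. psi1 x - f1 x)) = D - J"
      by (simp add: integral_unique)
    moreover have "integral {0..KK} (\<lambda>x. (flux (\<lambda>x. u x - e x) (\<lambda>x. psi1 x - f1 x) x)\<^sup>2) / 2
      \<le> integral {0..KK} (energy_dens (\<lambda>x. u x - e x) (\<lambda>x. u1 x - e1 x) (\<lambda>x. psi1 x - f1 x))"
      using u e ends by (intro dirichlet_bound continuous_intros cont ce cf) (auto intro!: derivative_intros)
    moreover have "0 \<le> integral {0..KK} (\<lambda>x. (flux (\<lambda>x. u x - e x) (\<lambda>x. psi1 x - f1 x) x)\<^sup>2)"
      by (intro integral_flux_sq(1) continuous_intros cont ce cf cu)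
    ultimately have "J \<le> D" by linarith
    then show ?thesis using pos by (simp add: D_def J_def)
  qed
  note flux = integral_flux_sq[OF cu cont(2)]
  show "0 \<le> integral {0..KK} (energy_dens u u1 psi1)" using bound flux(1) by linarith
  assume "integral {0..KK} (energy_dens u u1 psi1) = 0" "x \<in> {0..KK}"
  moreover have "integral {0..KK} (\<lambda>x. (flux u psi1 x)\<^sup>2) = 0"
    using calculation(1) flux(1) bound by linarith
  ultimately show "flux u psi1 x = 0" using flux(2) by blast
qed

text \<open>R and W are even, so the energy decouples into even u with odd psi and odd u with even
  psi. Equal end values make the odd part of psi vanish at 0 and \<open>KK\<close>, as
  \<open>half_period_bound\<close> requires, and likewise the odd part of u, as
  \<open>dirichlet_bound\<close> requires.\<close>

lemma full_period_bound:
  assumes u: "\<And>x. (u has_real_derivative u1 x) (at x)"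
    and psi: "\<And>x. (psi has_real_derivative psi1 x) (at x)"
    and ends: "u (- KK) = u KK" "psi (- KK) = psi KK"
    and cont: "continuous_on UNIV u1" "continuous_on UNIV psi1"
    and c1: "((\<lambda>x. u x * R x) has_integral 0) {-KK..KK}"
    and c2: "((\<lambda>x. R x * flux u psi1 x) has_integral 0) {-KK..KK}"
  shows "0 \<le> integral {-KK..KK} (energy_dens u u1 psi1)"
    and "integral {-KK..KK} (energy_dens u u1 psi1) = 0 \<Longrightarrow> x \<in> {-KK..KK} \<Longrightarrow> flux u psi1 x = 0"
proof -
  have cu: "continuous_on UNIV u" using u by (intro continuous_at_imp_continuous_on) (auto intro: DERIV_isCont)
  note c = cu cont
  have cr: "continuous_on A v" "continuous_on A (\<lambda>x. v (- x))" if "continuous_on UNIV v" for v :: "real \<Rightarrow> real" and A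
    using continuous_on_subset[OF that]
    by (auto intro!: continuous_on_compose2[OF that] continuous_intros)
  \<comment> \<open>The parity parts are taken without the factor 1/2, which accounts for the 1/2 in
    \<open>split0\<close>.\<close>
  define ue where "ue x = u x + u (- x)" for x
  define uo where "uo x = u x - u (- x)" for x
  define ue1 where "ue1 x = u1 x - u1 (- x)" for x
  define uo1 where "uo1 x = u1 x + u1 (- x)" for x
  define pe where "pe x = psi x - psi (- x)" for x
  define pe1 where "pe1 x = psi1 x + psi1 (- x)" for x
  define po1 where "po1 x = psi1 x - psi1 (- x)" for x
  have um: "((\<lambda>x. u (- x)) has_real_derivative - u1 (- x)) (at x)"
    "((\<lambda>x. psi (- x)) has_real_derivative - psi1 (- x)) (at x)" for x
    by (simp_all add: DERIV_mirror[symmetric] u psi)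
  have ders: "(ue has_real_derivative ue1 x) (at x)" "(uo has_real_derivative uo1 x) (at x)"
    "(pe has_real_derivative pe1 x) (at x)" for x
    unfolding ue_def[abs_def] ue1_def uo_def[abs_def] uo1_def pe_def[abs_def] pe1_def
    using DERIV_add[OF u um(1)] DERIV_diff[OF u um(1)] DERIV_diff[OF psi um(2)] by simp_all
  have conts: "continuous_on A ue" "continuous_on A ue1" "continuous_on A uo" "continuous_on A uo1"
    "continuous_on A pe1" "continuous_on A po1" for A
    unfolding ue_def[abs_def] ue1_def[abs_def] uo_def[abs_def] uo1_def[abs_def] pe1_def[abs_def] po1_def[abs_def]
    by (simp_all add: continuous_on_add continuous_on_diff cr[OF c(1)] cr[OF c(2)] cr[OF c(3)])
  have he: "flux ue pe1 x = flux u psi1 x + flux u psi1 (- x)" for x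
    by (simp add: flux_def ue_def pe1_def R_def rho_minus algebra_simps add_divide_distrib)
  have ho: "flux uo po1 x = flux u psi1 x - flux u psi1 (- x)" for x
    by (simp add: flux_def uo_def po1_def R_def rho_minus algebra_simps diff_divide_distrib)
  have W_minus: "W (- x) = W x" for x by (simp add: W_def rho_minus)
  have split0: "energy_dens u u1 psi1 x + energy_dens u u1 psi1 (- x) = 1 / 2 * (energy_dens ue ue1 pe1 x + energy_dens uo uo1 po1 x)" for x
    unfolding energy_dens_def he ho ue_def uo_def ue1_def uo1_def W_minus by (simp add: field_simps power2_eq_square)
  have "integral {-KK..KK} (energy_dens u u1 psi1) = integral {0..KK} (\<lambda>x. energy_dens u u1 psi1 x + energy_dens u u1 psi1 (- x))"
    using KK_pos by (intro integral_symmetric_interval continuous_energy_dens c) auto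
  also have "\<dots> = integral {0..KK} (\<lambda>x. 1 / 2 * (energy_dens ue ue1 pe1 x + energy_dens uo uo1 po1 x))"
    by (simp only: split0)
  also have "\<dots> = 1 / 2 * integral {0..KK} (\<lambda>x. energy_dens ue ue1 pe1 x + energy_dens uo uo1 po1 x)"
    by (rule integral_mult_right)
  also have "integral {0..KK} (\<lambda>x. energy_dens ue ue1 pe1 x + energy_dens uo uo1 po1 x)
     = integral {0..KK} (energy_dens ue ue1 pe1) + integral {0..KK} (energy_dens uo uo1 po1)"
    by (intro integral_add integrable_continuous_real continuous_energy_dens conts)
  finally have split: "integral {-KK..KK} (energy_dens u u1 psi1)
     = 1 / 2 * (integral {0..KK} (energy_dens ue ue1 pe1) + integral {0..KK} (energy_dens uo uo1 po1))" .
  have half: "((\<lambda>x. f x + f (- x)) has_integral 0) {0..KK}"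
    if f: "(f has_integral 0) {-KK..KK}" "continuous_on UNIV f" for f :: "real \<Rightarrow> real"
  proof -
    have "(\<lambda>x. f x + f (- x)) integrable_on {0..KK}"
      by (intro integrable_continuous_real continuous_on_add cr[OF f(2)])
    then show ?thesis
      using integral_symmetric_interval[OF f(2), of KK] KK_pos f(1) by (simp add: has_integral_iff)
  qed
  have ce1: "((\<lambda>x. ue x * R x) has_integral 0) {0..KK}"
    using half[OF c1 continuous_on_mult[OF c(1) continuous_R]]
    by (simp add: ue_def R_def rho_minus algebra_simps)
  have ce2: "((\<lambda>x. R x * flux ue pe1 x) has_integral 0) {0..KK}"
    using half[OF c2 continuous_on_mult[OF continuous_R continuous_flux[OF c(1,3)]]]
    by (simp add: he R_def rho_minus algebra_simps)
  have "pe 0 = 0" "pe KK = 0" using ends by (simp_all add: pe_def)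
  note even = half_period_bound[OF ders(1) ders(3) this conts(2,5) ce1 ce2]
  have "uo 0 = 0" "uo KK = 0" using ends by (simp_all add: uo_def)
  then have "integral {0..KK} (\<lambda>x. (flux uo po1 x)\<^sup>2) / 2 \<le> integral {0..KK} (energy_dens uo uo1 po1)"
    by (rule dirichlet_bound[OF ders(2) conts(4,6)])
  then have odd: "0 \<le> integral {0..KK} (energy_dens uo uo1 po1)"
    "integral {0..KK} (energy_dens uo uo1 po1) = 0 \<Longrightarrow> x \<in> {0..KK} \<Longrightarrow> flux uo po1 x = 0" for x
    using integral_flux_sq[OF conts(3,6)] by (auto intro: antisym)
  show "0 \<le> integral {-KK..KK} (energy_dens u u1 psi1)" using split even odd by simp
  assume z: "integral {-KK..KK} (energy_dens u u1 psi1) = 0" and x: "x \<in> {-KK..KK}"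
  have "integral {0..KK} (energy_dens ue ue1 pe1) = 0" "integral {0..KK} (energy_dens uo uo1 po1) = 0"
    using z split even(1) odd(1) by (simp_all add: add_nonneg_eq_0_iff)
  then have *: "flux ue pe1 \<bar>x\<bar> = 0" "flux uo po1 \<bar>x\<bar> = 0" using even(2) odd(2) x by auto
  then show "flux u psi1 x = 0" by (cases "x \<ge> 0") (auto simp: he ho)
qed

section \<open>The eigenvalue problem\<close>

definition pot_minus :: "real \<Rightarrow> real" where "pot_minus x = - rho x - om + cc\<^sup>2 / (2 * R x ^ 4)"

definition pot_plus :: "real \<Rightarrow> real" where "pot_plus x = - 3 * rho x - om + cc\<^sup>2 / (2 * R x ^ 4)"

definition real_S :: "(real \<Rightarrow> real) \<Rightarrow> (real \<Rightarrow> real) \<Rightarrow> real \<Rightarrow> real" where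
  "real_S u u1 x = cc / rho x * u1 x - cc * R1 x / R x ^ 3 * u x"

text \<open>The equation L(u, v) = (f, g) for real functions, solved for the second derivatives. A
  complex eigenfunction yields two such systems, coupled through \<open>f\<close> and
  \<open>g\<close>.\<close>

definition lin_sys where
  "lin_sys u u1 v v1 f g \<longleftrightarrow> (\<forall>x.
     (u has_real_derivative u1 x) (at x) \<and> (v has_real_derivative v1 x) (at x) \<and>
     (v1 has_real_derivative 2 * (pot_minus x * v x - real_S u u1 x - f x)) (at x) \<and>
     (u1 has_real_derivative 2 * (pot_plus x * u x + real_S v v1 x + g x)) (at x))"

text \<open>This is $R h$ for $v = R\psi$.\<close>

definition R_flux :: "(real \<Rightarrow> real) \<Rightarrow> (real \<Rightarrow> real) \<Rightarrow> (real \<Rightarrow> real) \<Rightarrow> real \<Rightarrow> real" where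
  "R_flux u v v1 x = R x * v1 x - R1 x * v x + 2 * cc * u x / R x"

text \<open>Gauge invariance: R lies in the kernel of L_-, so the first equation times R is an exact
  derivative.\<close>

lemma R_flux_deriv:
  assumes "lin_sys u u1 v v1 f g"
  shows "(R_flux u v v1 has_real_derivative - 2 * R x * f x) (at x)"
proof -
  have R0: "R x \<noteq> 0" using R_pos[of x] by simp
  have D: "(R_flux u v v1 has_real_derivative R1 x * v1 x + R x * (2 * (pot_minus x * v x - real_S u u1 x - f x))
      - (R2 x * v x + R1 x * v1 x) + 2 * cc * (u1 x / R x - u x * R1 x / (R x)\<^sup>2)) (at x)"
    unfolding R_flux_def[abs_def] using assms R0
    by (auto intro!: derivative_eq_intros R_deriv R1_deriv simp: lin_sys_def field_simps power2_eq_square)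
  have E: "R1 x * v1 x + R x * (2 * (pot_minus x * v x - real_S u u1 x - f x))
      - (R2 x * v x + R1 x * v1 x) + 2 * cc * (u1 x / R x - u x * R1 x / (R x)\<^sup>2) = - 2 * R x * f x"
    unfolding pot_minus_def real_S_def R2_def rho_eq using R0 by (simp add: field_simps eval_nat_numeral)
  from D E show ?thesis by (rule DERIV_cong)
qed

text \<open>Translation invariance: as M R' = 0, the second equation times R' combines with the
  first times c / R into an exact derivative.\<close>

lemma momentum_deriv:
  assumes "lin_sys u u1 v v1 f g"
  shows "((\<lambda>x. - (R1 x * u1 x - R2 x * u x) / 2 - cc / 2 * (R_flux u v v1 x / rho x)) has_real_derivative
      - R1 x * g x + cc * f x / R x) (at x)"
proof -
  have R0: "R x \<noteq> 0" "rho x \<noteq> 0" using R_pos[of x] rho_pos[of x] by simp_all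
  have D: "((\<lambda>x. - (R1 x * u1 x - R2 x * u x) / 2 - cc / 2 * (R_flux u v v1 x / rho x)) has_real_derivative
      - (R2 x * u1 x + R1 x * (2 * (pot_plus x * u x + real_S v v1 x + g x)) - (2 * W x * R1 x * u x + R2 x * u1 x)) / 2
      - cc / 2 * ((- 2 * R x * f x * rho x - R_flux u v v1 x * rho1 x) / (rho x)\<^sup>2)) (at x)"
    using assms R0
    by (auto intro!: derivative_eq_intros R1_deriv R2_deriv rho_deriv R_flux_deriv[OF assms]
        simp: lin_sys_def power2_eq_square field_simps)
  have E: "- (R2 x * u1 x + R1 x * (2 * (pot_plus x * u x + real_S v v1 x + g x)) - (2 * W x * R1 x * u x + R2 x * u1 x)) / 2
      - cc / 2 * ((- 2 * R x * f x * rho x - R_flux u v v1 x * rho1 x) / (rho x)\<^sup>2) = - R1 x * g x + cc * f x / R x"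
    unfolding pot_plus_def real_S_def W_def R_flux_def rho_eq rho1_eq using R0 by (simp add: field_simps eval_nat_numeral)
  from D E show ?thesis by (rule DERIV_cong)
qed

lemma energy_deriv:
  assumes uv: "lin_sys u u1 v v1 f g" and ab: "lin_sys u' u1' v' v1' f' g'"
  shows "((\<lambda>x. (R_flux u v v1 x * v' x / R x + u1 x * u' x) / 2) has_real_derivative
     R_flux u v v1 x * R_flux u' v' v1' x / (2 * (R x)\<^sup>2) + (u1 x * u1' x / 2 + W x * u x * u' x)
     + g x * u' x - f x * v' x) (at x)"
proof -
  have R0: "R x \<noteq> 0" using R_pos[of x] by simp
  have D: "((\<lambda>x. (R_flux u v v1 x * v' x / R x + u1 x * u' x) / 2) has_real_derivative
     ((- 2 * R x * f x) * v' x / R x + R_flux u v v1 x * (v1' x / R x - v' x * R1 x / (R x)\<^sup>2)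
      + (2 * (pot_plus x * u x + real_S v v1 x + g x)) * u' x + u1 x * u1' x) / 2) (at x)"
    using uv ab R0
    by (auto intro!: derivative_eq_intros R_deriv R_flux_deriv[OF uv]
        simp: lin_sys_def power2_eq_square field_simps)
  have E: "((- 2 * R x * f x) * v' x / R x + R_flux u v v1 x * (v1' x / R x - v' x * R1 x / (R x)\<^sup>2)
      + (2 * (pot_plus x * u x + real_S v v1 x + g x)) * u' x + u1 x * u1' x) / 2 =
     R_flux u v v1 x * R_flux u' v' v1' x / (2 * (R x)\<^sup>2) + (u1 x * u1' x / 2 + W x * u x * u' x)
     + g x * u' x - f x * v' x"
    unfolding pot_plus_def real_S_def W_def R_flux_def rho_eq using R0 by (simp add: field_simps eval_nat_numeral)
  from D E show ?thesis by (rule DERIV_cong)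
qed

section \<open>Vanishing of eigenfunctions off the imaginary axis\<close>

lemma period_integral:
  assumes "\<And>x. (F has_real_derivative f x) (at x)" "F (- KK) = F KK"
  shows "(f has_integral 0) {-KK..KK}"
  using has_integral_derivative[of "-KK" KK F f] assms KK_pos by simp

text \<open>The two systems are the real and imaginary parts of the eigenvalue equations at \<mu> +
  i \<sigma>. Both parts satisfy the constraints and their energies add up to zero, so each energy
  is zero and the flux vanishes; the equations then kill U and V in turn.\<close>

lemma lin_sys_unique:
  assumes sr: "lin_sys ur ur1 vr vr1 (\<lambda>x. \<mu> * ur x - \<sigma> * ui x) (\<lambda>x. \<mu> * vr x - \<sigma> * vi x)"
    and si: "lin_sys ui ui1 vi vi1 (\<lambda>x. \<sigma> * ur x + \<mu> * ui x) (\<lambda>x. \<sigma> * vr x + \<mu> * vi x)"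
    and per: "\<And>x. ur (x + 2 * KK) = ur x" "\<And>x. ui (x + 2 * KK) = ui x"
      "\<And>x. vr (x + 2 * KK) = vr x" "\<And>x. vi (x + 2 * KK) = vi x"
    and mu: "\<mu> \<noteq> 0"
  shows "ur x = 0 \<and> ui x = 0 \<and> vr x = 0 \<and> vi x = 0"
proof -
  have d: "(ur has_real_derivative ur1 x) (at x)" "(ui has_real_derivative ui1 x) (at x)"
    "(vr has_real_derivative vr1 x) (at x)" "(vi has_real_derivative vi1 x) (at x)" for x
    using sr si by (auto simp: lin_sys_def)
  note per1 = periodic_deriv[OF d(1) per(1)] periodic_deriv[OF d(2) per(2)]
    periodic_deriv[OF d(3) per(3)] periodic_deriv[OF d(4) per(4)]
  note ends = per[of "-KK", symmetric, simplified] per1[of "-KK", symmetric, simplified]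
  have Rends: "rho (-KK) = rho KK" "R (-KK) = R KK" "R1 (-KK) = 0" "R1 KK = 0" "R2 (-KK) = R2 KK"
    by (simp_all add: rho_minus R_def R1_def R2_def rho1_minus rho1_KK)
  define yr where "yr = R_flux ur vr vr1"
  define yi where "yi = R_flux ui vi vi1"
  have yends: "yr (-KK) = yr KK" "yi (-KK) = yi KK"
    by (simp_all add: yr_def yi_def R_flux_def ends Rends)
  note defs = yr_def[symmetric] yi_def[symmetric]
  have R0: "R x \<noteq> 0" for x using R_pos[of x] by simp

  have "((\<lambda>x. \<mu> * (- 2 * R x * ur x) - \<sigma> * (- 2 * R x * ui x)) has_integral 0) {-KK..KK}"
    by (rule period_integral[OF _ yends(1)], rule DERIV_cong[OF R_flux_deriv[OF sr, folded yr_def]])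
      (simp add: algebra_simps)
  moreover have "((\<lambda>x. \<sigma> * (- 2 * R x * ur x) + \<mu> * (- 2 * R x * ui x)) has_integral 0) {-KK..KK}"
    by (rule period_integral[OF _ yends(2)], rule DERIV_cong[OF R_flux_deriv[OF si, folded yi_def]])
      (simp add: algebra_simps)
  ultimately have "((\<lambda>x. - 2 * R x * ur x) has_integral 0) {-KK..KK}"
    "((\<lambda>x. - 2 * R x * ui x) has_integral 0) {-KK..KK}"
    by (rule has_integral_rotation[OF _ _ mu])+
  from this[THEN has_integral_mult_right[where c = "- 1 / 2"]]
  have c1: "((\<lambda>x. ur x * R x) has_integral 0) {-KK..KK}" "((\<lambda>x. ui x * R x) has_integral 0) {-KK..KK}"
    by (simp_all add: mult.commute)

  \<comment> \<open>Adding half of lambda R V to the momentum identity turns its right-hand side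
    into half of lambda R h, which gives the second constraint.\<close>
  have Rv: "((\<lambda>x. R x * vr x) has_real_derivative R1 x * vr x + R x * vr1 x) (at x)"
    "((\<lambda>x. R x * vi x) has_real_derivative R1 x * vi x + R x * vi1 x) (at x)" for x
    using d by (auto intro!: derivative_eq_intros R_deriv)
  have "((\<lambda>x. \<mu> * (yr x / 2) - \<sigma> * (yi x / 2)) has_integral 0) {-KK..KK}"
  proof (rule period_integral)
    fix x
    show "((\<lambda>x. (- (R1 x * ur1 x - R2 x * ur x) / 2 - cc / 2 * (R_flux ur vr vr1 x / rho x))
       + \<mu> * (R x * vr x) / 2 - \<sigma> * (R x * vi x) / 2) has_real_derivative \<mu> * (yr x / 2) - \<sigma> * (yi x / 2)) (at x)"
      by (rule DERIV_cong, rule DERIV_diff[OF DERIV_add[OF momentum_deriv[OF sr] DERIV_cdivide[OF DERIV_cmult[OF Rv(1)]]]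
           DERIV_cdivide[OF DERIV_cmult[OF Rv(2)]]])
        (use R0[of x] in \<open>simp add: yr_def yi_def R_flux_def field_simps\<close>)
  qed (simp add: defs yends ends Rends)
  moreover have "((\<lambda>x. \<sigma> * (yr x / 2) + \<mu> * (yi x / 2)) has_integral 0) {-KK..KK}"
  proof (rule period_integral)
    fix x
    show "((\<lambda>x. (- (R1 x * ui1 x - R2 x * ui x) / 2 - cc / 2 * (R_flux ui vi vi1 x / rho x))
       + \<sigma> * (R x * vr x) / 2 + \<mu> * (R x * vi x) / 2) has_real_derivative \<sigma> * (yr x / 2) + \<mu> * (yi x / 2)) (at x)"
      by (rule DERIV_cong, rule DERIV_add[OF DERIV_add[OF momentum_deriv[OF si] DERIV_cdivide[OF DERIV_cmult[OF Rv(1)]]]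
           DERIV_cdivide[OF DERIV_cmult[OF Rv(2)]]])
        (use R0[of x] in \<open>simp add: yr_def yi_def R_flux_def field_simps\<close>)
  qed (simp add: defs yends ends Rends)
  ultimately have "((\<lambda>x. yr x / 2) has_integral 0) {-KK..KK}" "((\<lambda>x. yi x / 2) has_integral 0) {-KK..KK}"
    by (rule has_integral_rotation[OF _ _ mu])+
  from this[THEN has_integral_mult_right[where c = 2]]
  have c2: "(yr has_integral 0) {-KK..KK}" "(yi has_integral 0) {-KK..KK}" by simp_all

  \<comment> \<open>The polarised energy is symmetric, so it cancels in the difference of the two
    cross pairings and only the terms with \<open>\<mu>\<close> are left.\<close>
  have "((\<lambda>x. 2 * \<mu> * (vi x * ur x - ui x * vr x)) has_integral 0) {-KK..KK}"
  proof (rule period_integral)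
    fix x
    show "((\<lambda>x. (yi x * vr x / R x + ui1 x * ur x) / 2 - (yr x * vi x / R x + ur1 x * ui x) / 2)
        has_real_derivative 2 * \<mu> * (vi x * ur x - ui x * vr x)) (at x)"
      unfolding yr_def yi_def
      by (rule DERIV_cong, rule DERIV_diff[OF energy_deriv[OF si sr] energy_deriv[OF sr si]])
        (simp add: algebra_simps)
  qed (simp add: yends ends Rends)
  from has_integral_mult_right[OF this, of "inverse (2 * \<mu>)"]
  have s: "((\<lambda>x. vi x * ur x - ui x * vr x) has_integral 0) {-KK..KK}"
    using mu by (simp flip: mult.assoc)
  define wr where "wr x = vr x / R x" for x
  define wi where "wi x = vi x / R x" for x
  define wr1 where "wr1 x = vr1 x / R x - vr x * R1 x / (R x)\<^sup>2" for x
  define wi1 where "wi1 x = vi1 x / R x - vi x * R1 x / (R x)\<^sup>2" for x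
  have hr: "flux ur wr1 x = yr x / R x" "flux ui wi1 x = yi x / R x" for x
    unfolding flux_def wr1_def wi1_def yr_def yi_def R_flux_def rho_eq using R0[of x]
    by (simp_all add: field_simps power2_eq_square)
  have dp: "(wr has_real_derivative wr1 x) (at x)" "(wi has_real_derivative wi1 x) (at x)" for x
    unfolding wr_def[abs_def] wi_def[abs_def] wr1_def wi1_def using R0[of x]
    by (auto intro!: derivative_eq_intros d R_deriv simp: field_simps power2_eq_square)
  \<comment> \<open>The sum of the two diagonal pairings brings in \<open>\<sigma>\<close> times the
    integral just shown to vanish, so the total energy is zero.\<close>
  have "((\<lambda>x. energy_dens ur ur1 wr1 x + energy_dens ui ui1 wi1 x - 2 * \<sigma> * (vi x * ur x - ui x * vr x)) has_integral 0) {-KK..KK}"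
  proof (rule period_integral)
    fix x
    show "((\<lambda>x. (yr x * vr x / R x + ur1 x * ur x) / 2 + (yi x * vi x / R x + ui1 x * ui x) / 2)
        has_real_derivative energy_dens ur ur1 wr1 x + energy_dens ui ui1 wi1 x - 2 * \<sigma> * (vi x * ur x - ui x * vr x)) (at x)"
      unfolding energy_dens_def hr unfolding yr_def yi_def
      by (rule DERIV_cong, rule DERIV_add[OF energy_deriv[OF sr sr] energy_deriv[OF si si]])
        (simp add: algebra_simps power2_eq_square)
  qed (simp add: yends ends Rends)
  from has_integral_add[OF this has_integral_mult_right[OF s, of "2 * \<sigma>"]]
  have I0: "((\<lambda>x. energy_dens ur ur1 wr1 x + energy_dens ui ui1 wi1 x) has_integral 0) {-KK..KK}" by simp
  have contD: "continuous_on UNIV v" if "\<And>x. (v has_real_derivative v' x) (at x)" for v v'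
    using that by (intro continuous_at_imp_continuous_on) (auto intro: DERIV_isCont)
  have contL: "continuous_on UNIV ur1" "continuous_on UNIV vr1" "continuous_on UNIV ui1" "continuous_on UNIV vi1"
    using sr si by (auto simp: lin_sys_def intro!: continuous_at_imp_continuous_on intro: DERIV_isCont)
  have contp: "continuous_on UNIV wr1" "continuous_on UNIV wi1"
    unfolding wr1_def[abs_def] wi1_def[abs_def]
    using contL contD[OF d(3)] contD[OF d(4)] R0
    by (auto intro!: continuous_intros continuous_R continuous_R1)
  have int: "(energy_dens ur ur1 wr1 has_integral integral {-KK..KK} (energy_dens ur ur1 wr1)) {-KK..KK}"
    "(energy_dens ui ui1 wi1 has_integral integral {-KK..KK} (energy_dens ui ui1 wi1)) {-KK..KK}"
    using continuous_on_subset[OF continuous_energy_dens[OF contD[OF d(1)] contL(1) contp(1)] subset_UNIV]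
      continuous_on_subset[OF continuous_energy_dens[OF contD[OF d(2)] contL(3) contp(2)] subset_UNIV]
    by (auto intro!: integrable_integral integrable_continuous_real)
  have sum0: "integral {-KK..KK} (energy_dens ur ur1 wr1) + integral {-KK..KK} (energy_dens ui ui1 wi1) = 0"
    using has_integral_unique[OF has_integral_add[OF int] I0] .
  have cy: "((\<lambda>x. R x * flux ur wr1 x) has_integral 0) {-KK..KK}" "((\<lambda>x. R x * flux ui wi1 x) has_integral 0) {-KK..KK}"
    unfolding hr using c2 R0 by simp_all
  have pends: "wr (-KK) = wr KK" "wi (-KK) = wi KK" by (simp_all add: wr_def wi_def ends Rends)
  note br = full_period_bound[OF d(1) dp(1) ends(1) pends(1) contL(1) contp(1) c1(1) cy(1)]
    and bi = full_period_bound[OF d(2) dp(2) ends(2) pends(2) contL(3) contp(2) c1(2) cy(2)]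
  have "integral {-KK..KK} (energy_dens ur ur1 wr1) = 0" "integral {-KK..KK} (energy_dens ui ui1 wi1) = 0"
    using sum0 br(1) bi(1) by (simp_all add: add_nonneg_eq_0_iff)
  then have "yr x = 0" "yi x = 0" if "x \<in> {-KK..KK}" for x
    using br(2)[of x] bi(2)[of x] that hr[of x] R0[of x] by auto
  moreover have "yr (x + 2 * KK) = yr x" "yi (x + 2 * KK) = yi x" for x
    by (simp_all add: yr_def yi_def R_flux_def per per1 R_def R1_def rho_period rho1_period)
  ultimately have y0: "yr x = 0" "yi x = 0" for x
    using periodic_zero[of yr KK x] periodic_zero[of yi KK x] KK_pos by blast+
  \<comment> \<open>Multiplication by the nonzero number \<mu> + i \<sigma> is injective.\<close>
  have rot: "p = 0 \<and> q = 0" if "\<mu> * p - \<sigma> * q = 0" "\<sigma> * p + \<mu> * q = 0" for p q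
  proof -
    have "(\<mu>\<^sup>2 + \<sigma>\<^sup>2) * p = \<mu> * (\<mu> * p - \<sigma> * q) + \<sigma> * (\<sigma> * p + \<mu> * q)"
      "(\<mu>\<^sup>2 + \<sigma>\<^sup>2) * q = \<mu> * (\<sigma> * p + \<mu> * q) - \<sigma> * (\<mu> * p - \<sigma> * q)"
      by (simp_all add: algebra_simps power2_eq_square)
    moreover have "\<mu>\<^sup>2 + \<sigma>\<^sup>2 \<noteq> 0" using mu by (simp add: sum_power2_eq_zero_iff)
    ultimately show ?thesis using that mu by simp
  qed
  have zero_deriv: "v' x = 0" if "\<And>x. v x = 0" "(v has_real_derivative v' x) (at x)" for v v' :: "real \<Rightarrow> real" and x
  proof -
    have "v = (\<lambda>x. 0)" using that(1) by auto
    then show ?thesis using DERIV_unique[OF that(2)] by simp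
  qed
  have u0: "ur x = 0 \<and> ui x = 0" for x
  proof (rule rot)
    show "\<mu> * ur x - \<sigma> * ui x = 0" "\<sigma> * ur x + \<mu> * ui x = 0"
      using zero_deriv[of yr "\<lambda>x. - 2 * R x * (\<mu> * ur x - \<sigma> * ui x)" x]
        zero_deriv[of yi "\<lambda>x. - 2 * R x * (\<sigma> * ur x + \<mu> * ui x)" x]
        y0 R_flux_deriv[OF sr, folded yr_def] R_flux_deriv[OF si, folded yi_def] R0[of x] by auto
  qed
  have u1: "ur1 x = 0" "ui1 x = 0" for x
    using zero_deriv[of ur ur1] zero_deriv[of ui ui1] u0 d by auto
  \<comment> \<open>For U = 0 the term S V is c / R^3 times the vanishing R h, so the second
    equation reduces to lambda V = 0.\<close>
  have real_S: "real_S vr vr1 x = 0" "real_S vi vi1 x = 0" for x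
  proof -
    have "real_S vr vr1 x = cc * yr x / R x ^ 3" "real_S vi vi1 x = cc * yi x / R x ^ 3"
      unfolding real_S_def yr_def yi_def R_flux_def rho_eq using u0 R0[of x]
      by (simp_all add: field_simps power3_eq_cube)
    then show "real_S vr vr1 x = 0" "real_S vi vi1 x = 0" by (simp_all add: y0)
  qed
  have "vr x = 0 \<and> vi x = 0"
  proof (rule rot)
    have "(ur1 has_real_derivative 2 * (pot_plus x * ur x + real_S vr vr1 x + (\<mu> * vr x - \<sigma> * vi x))) (at x)"
      "(ui1 has_real_derivative 2 * (pot_plus x * ui x + real_S vi vi1 x + (\<sigma> * vr x + \<mu> * vi x))) (at x)"
      using sr si by (auto simp: lin_sys_def)
    then show "\<mu> * vr x - \<sigma> * vi x = 0" "\<sigma> * vr x + \<mu> * vi x = 0"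
      using zero_deriv[of ur1 "\<lambda>x. 2 * (pot_plus x * ur x + real_S vr vr1 x + (\<mu> * vr x - \<sigma> * vi x))" x]
        zero_deriv[of ui1 "\<lambda>x. 2 * (pot_plus x * ui x + real_S vi vi1 x + (\<sigma> * vr x + \<mu> * vi x))" x] u0 u1 real_S by auto
  qed
  then show ?thesis using u0 by blast
qed

section \<open>From complex eigenfunctions to real systems\<close>

lemma spectrally_stable: "spectrally_stable k b (2 * KK)"
  unfolding spectrally_stable_def
proof (intro allI impI)
  fix lam U V
  assume ep: "periodic_eigenpair k b (2 * KK) lam U V"
  show "Re lam = 0"
  proof (rule ccontr)
    assume mu: "Re lam \<noteq> 0"
    have tw: "(U has_vector_derivative Dx U x) (at x)" "(V has_vector_derivative Dx V x) (at x)"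
      "(Dx U has_vector_derivative Dx (Dx U) x) (at x)" "(Dx V has_vector_derivative Dx (Dx V) x) (at x)" for x
      using ep by (auto simp: periodic_eigenpair_def twice_differentiable_def Dx_def vector_derivative_works)
    note re = tw[THEN bounded_linear.has_vector_derivative[OF bounded_linear_Re],
        folded has_real_derivative_iff_has_vector_derivative]
    note im = tw[THEN bounded_linear.has_vector_derivative[OF bounded_linear_Im],
        folded has_real_derivative_iff_has_vector_derivative]
    have dR: "deriv R x = R1 x" for x using R_deriv by (rule DERIV_imp_deriv)
    have eq1: "lam * U x = - op_S k b U x + op_Lminus k b V x"
      and eq2: "lam * V x = - op_Lplus k b U x - op_S k b V x" for x
      using ep by (auto simp: periodic_eigenpair_def op_L_def fun_eq_iff)
    have SSc: "Re (op_S k b f x) = real_S (\<lambda>x. Re (f x)) (\<lambda>x. Re (Dx f x)) x"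
      "Im (op_S k b f x) = real_S (\<lambda>x. Im (f x)) (\<lambda>x. Im (Dx f x)) x" for f x
      by (simp_all add: op_S_def real_S_def R_sol_R dR R_sq flip: cc_def)
    have Lm: "Re (op_Lminus k b f x) = - Re (Dx (Dx f) x) / 2 + pot_minus x * Re (f x)"
      "Im (op_Lminus k b f x) = - Im (Dx (Dx f) x) / 2 + pot_minus x * Im (f x)" for f x
      by (simp_all add: op_Lminus_def pot_minus_def R_sol_R R_sq flip: cc_def om_def)
    have Lp: "Re (op_Lplus k b f x) = - Re (Dx (Dx f) x) / 2 + pot_plus x * Re (f x)"
      "Im (op_Lplus k b f x) = - Im (Dx (Dx f) x) / 2 + pot_plus x * Im (f x)" for f x
      by (simp_all add: op_Lplus_def pot_plus_def R_sol_R R_sq flip: cc_def om_def)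
    have "lin_sys (\<lambda>x. Re (U x)) (\<lambda>x. Re (Dx U x)) (\<lambda>x. Re (V x)) (\<lambda>x. Re (Dx V x))
       (\<lambda>x. Re lam * Re (U x) - Im lam * Im (U x)) (\<lambda>x. Re lam * Re (V x) - Im lam * Im (V x))"
      unfolding lin_sys_def
    proof (intro allI conjI)
      fix x
      have "Re (Dx (Dx V) x) = 2 * (pot_minus x * Re (V x) - real_S (\<lambda>x. Re (U x)) (\<lambda>x. Re (Dx U x)) x - (Re lam * Re (U x) - Im lam * Im (U x)))"
        "Re (Dx (Dx U) x) = 2 * (pot_plus x * Re (U x) + real_S (\<lambda>x. Re (V x)) (\<lambda>x. Re (Dx V x)) x + (Re lam * Re (V x) - Im lam * Im (V x)))"
        using arg_cong[OF eq1[of x], of Re] arg_cong[OF eq2[of x], of Re] by (auto simp: SSc Lm Lp)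
      then show "((\<lambda>x. Re (Dx V x)) has_real_derivative 2 * (pot_minus x * Re (V x) - real_S (\<lambda>x. Re (U x)) (\<lambda>x. Re (Dx U x)) x - (Re lam * Re (U x) - Im lam * Im (U x)))) (at x)"
        "((\<lambda>x. Re (Dx U x)) has_real_derivative 2 * (pot_plus x * Re (U x) + real_S (\<lambda>x. Re (V x)) (\<lambda>x. Re (Dx V x)) x + (Re lam * Re (V x) - Im lam * Im (V x)))) (at x)"
        using re by metis+
    qed (use re in auto)
    moreover have "lin_sys (\<lambda>x. Im (U x)) (\<lambda>x. Im (Dx U x)) (\<lambda>x. Im (V x)) (\<lambda>x. Im (Dx V x))
       (\<lambda>x. Im lam * Re (U x) + Re lam * Im (U x)) (\<lambda>x. Im lam * Re (V x) + Re lam * Im (V x))"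
      unfolding lin_sys_def
    proof (intro allI conjI)
      fix x
      have "Im (Dx (Dx V) x) = 2 * (pot_minus x * Im (V x) - real_S (\<lambda>x. Im (U x)) (\<lambda>x. Im (Dx U x)) x - (Im lam * Re (U x) + Re lam * Im (U x)))"
        "Im (Dx (Dx U) x) = 2 * (pot_plus x * Im (U x) + real_S (\<lambda>x. Im (V x)) (\<lambda>x. Im (Dx V x)) x + (Im lam * Re (V x) + Re lam * Im (V x)))"
        using arg_cong[OF eq1[of x], of Im] arg_cong[OF eq2[of x], of Im] by (auto simp: SSc Lm Lp)
      then show "((\<lambda>x. Im (Dx V x)) has_real_derivative 2 * (pot_minus x * Im (V x) - real_S (\<lambda>x. Im (U x)) (\<lambda>x. Im (Dx U x)) x - (Im lam * Re (U x) + Re lam * Im (U x)))) (at x)"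
        "((\<lambda>x. Im (Dx U x)) has_real_derivative 2 * (pot_plus x * Im (U x) + real_S (\<lambda>x. Im (V x)) (\<lambda>x. Im (Dx V x)) x + (Im lam * Re (V x) + Re lam * Im (V x)))) (at x)"
        using im by metis+
    qed (use im in auto)
    moreover have "U (x + 2 * KK) = U x" "V (x + 2 * KK) = V x" for x
      using ep by (auto simp: periodic_eigenpair_def)
    ultimately have "Re (U x) = 0 \<and> Im (U x) = 0 \<and> Re (V x) = 0 \<and> Im (V x) = 0" for x
      using mu by (intro lin_sys_unique) simp_all
    then have "U = (\<lambda>x. 0)" "V = (\<lambda>x. 0)" by (auto simp: fun_eq_iff complex_eq_iff)
    then show False using ep by (simp add: periodic_eigenpair_def)
  qed
qed

end

theorem theorem9p7:
  fixes k b :: real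
  assumes "0 < k" and "k < 1"
    and "k\<^sup>2 < b" and "b < 1"
    and "b > - 1 + k\<^sup>2 + 2 * ellE k / ellK k"
  shows "spectrally_stable k b (2 * ellK k)"
proof -
  interpret elliptic_wave k b using assms by unfold_locales
  show ?thesis by (rule spectrally_stable)
qed

end
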